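(* Let $\phi\colon \mathbb{D}\to\mathbb{D}$ be an analytic self-map of the open unit disk. Then there exists $w\in H^2$ with $w\not\equiv 0$ such that the weighted composition operator $M_wC_\phi\colon f\mapsto w\,(f\circ\phi)$ is a bounded and compact operator on $H^2$ if and only if $$m\big(\{\xi\in\mathbb{T} : |\phi^\ast(\xi)|=1\}\big)=0 .$$
   Context: $\mathbb{D}$ is the open unit disk, $\mathbb{T}=\partial\mathbb{D}$, and $m$ is the normalized Lebesgue (Haar) measure on $\mathbb{T}$. $H^2$ is the Hardy space of the disk. For an analytic self-map $\phi$ of $\mathbb{D}$, $\phi^\ast(\xi)=\lim_{r\to1^-}\phi(r\xi)$ denotes its radial limit function, defined $m$-almost everywhere. For $w\in H^2$, $M_wC_\phi$ is the operator $f\mapsto w\,(f\circ\phi)$. *)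

theory Defs
  imports "HOL-Analysis.Analysis"
begin

definition h2_mean :: "(complex \<Rightarrow> complex) \<Rightarrow> real \<Rightarrow> real" where
  "h2_mean f r = (1 / (2 * pi)) * (LINT t:{0..2*pi}|lborel. (cmod (f (of_real r * cis t)))\<^sup>2)"

text \<open>The Hardy space H^2 of the unit disk (functions are only relevant on the disk).\<close>
definition H2 :: "(complex \<Rightarrow> complex) set" where
  "H2 = {f. f holomorphic_on ball 0 1 \<and> bdd_above (h2_mean f ` {0..<1})}"

definition h2_norm :: "(complex \<Rightarrow> complex) \<Rightarrow> real" where
  "h2_norm f = sqrt (SUP r\<in>{0..<1}. h2_mean f r)"

definition bounded_on_H2 :: "((complex \<Rightarrow> complex) \<Rightarrow> (complex \<Rightarrow> complex)) \<Rightarrow> bool" where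
  "bounded_on_H2 T \<longleftrightarrow> (\<forall>f\<in>H2. T f \<in> H2) \<and> (\<exists>C. \<forall>f\<in>H2. h2_norm (T f) \<le> C * h2_norm f)"

definition compact_on_H2 :: "((complex \<Rightarrow> complex) \<Rightarrow> (complex \<Rightarrow> complex)) \<Rightarrow> bool" where
  "compact_on_H2 T \<longleftrightarrow> (\<forall>f :: nat \<Rightarrow> complex \<Rightarrow> complex.
      (\<forall>n. f n \<in> H2 \<and> h2_norm (f n) \<le> 1) \<longrightarrow>
      (\<exists>\<sigma> g. strict_mono \<sigma> \<and> g \<in> H2 \<and>
          (\<lambda>n. h2_norm (\<lambda>z. T (f (\<sigma> n)) z - g z)) \<longlonglongrightarrow> 0))"

definition wcomp :: "(complex \<Rightarrow> complex) \<Rightarrow> (complex \<Rightarrow> complex) \<Rightarrow> (complex \<Rightarrow> complex) \<Rightarrow> (complex \<Rightarrow> complex)" where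
  "wcomp w \<phi> f = (\<lambda>z. w z * f (\<phi> z))"

definition radial_unimodular :: "(complex \<Rightarrow> complex) \<Rightarrow> real \<Rightarrow> bool" where
  "radial_unimodular \<phi> t \<longleftrightarrow>
     (\<exists>L. cmod L = 1 \<and> ((\<lambda>r::real. \<phi> (of_real r * cis t)) \<longlongrightarrow> L) (at_left 1))"

end

theory Submission
  imports Defs "HOL-Complex_Analysis.Complex_Analysis"
begin

text \<open>
  Both sides are equivalent to \<open>\<parallel>\<phi>\<^sup>k\<parallel> \<rightarrow> 0\<close> in \<open>H\<^sup>2\<close>.  By Fatou's theorem and dominated convergence
  \<open>\<parallel>\<phi>\<^sup>k\<parallel>\<^sup>2\<close> tends to the normalized measure of the set where the radial limit of \<open>\<phi>\<close> is unimodular.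

  The link to operators is a harmonic majorant that is almost exact on the circle: up to an
  arbitrarily small error, \<open>\<bar>f\<bar>\<^sup>2 \<le> Re q\<close> on the disk with equality on the circle.  If \<open>\<parallel>\<phi>\<^sup>k\<parallel> \<rightarrow> 0\<close>, choose
  \<open>k\<^sub>j\<close> with summable squared norms; the product of the corresponding functions \<open>exp (- q\<^sub>j)\<close> is a bounded
  nonzero weight \<open>w\<close> that tends to \<open>0\<close> where \<open>\<bar>\<phi>\<bar>\<close> tends to \<open>1\<close>, which makes the operator compact because
  \<open>f \<mapsto> f \<circ> \<phi>\<close> is bounded.  Conversely, compactness forces \<open>\<parallel>w \<phi>\<^sup>k\<parallel> \<rightarrow> 0\<close> along a subsequence;
  evaluating \<open>w exp (K q / 2)\<close> at a point, where \<open>q\<close> belongs to \<open>\<phi>\<^sup>k\<close>, bounds \<open>\<bar>w\<bar>\<^sup>2\<close> there by a multiple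
  of \<open>exp (- c K)\<close> for every \<open>K\<close> unless \<open>\<parallel>\<phi>\<^sup>k\<parallel> \<rightarrow> 0\<close>.
\<close>

section \<open>Circle means and the Poisson formula\<close>

definition circle_mean :: "(complex \<Rightarrow> 'a::banach) \<Rightarrow> 'a" where
  "circle_mean g = (1 / (2 * pi)) *\<^sub>R integral {0..2*pi} (\<lambda>t. g (cis t))"

lemma continuous_on_circle_cis:
  "continuous_on (sphere 0 1) g \<Longrightarrow> continuous_on S (\<lambda>t. g (cis t))"
  by (rule continuous_on_compose2[of "sphere 0 1" g]) (auto intro!: continuous_intros)

lemma integrable_circle_cis:
  fixes g :: "complex \<Rightarrow> 'a::banach"
  shows "continuous_on (sphere 0 1) g \<Longrightarrow> (\<lambda>t. g (cis t)) integrable_on {a..b::real}"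
  by (intro integrable_continuous_real continuous_on_circle_cis)

lemma circle_mean_const [simp]: "circle_mean (\<lambda>z. c) = c"
  by (simp add: circle_mean_def)

lemma circle_mean_add:
  assumes "continuous_on (sphere 0 1) f" "continuous_on (sphere 0 1) g"
  shows "circle_mean (\<lambda>z. f z + g z) = circle_mean f + circle_mean g"
  using assms by (simp add: circle_mean_def integral_add integrable_circle_cis scaleR_add_right)

lemma circle_mean_bounded_linear:
  assumes "bounded_linear h" "continuous_on (sphere 0 1) f"
  shows "circle_mean (\<lambda>z. h (f z)) = h (circle_mean f)"
  using integral_linear[OF integrable_circle_cis[OF assms(2)] assms(1), of 0 "2*pi"]
  by (simp add: circle_mean_def o_def linear_scale[OF bounded_linear.linear[OF assms(1)]])

lemma circle_mean_mult_left:
  fixes c :: "'a::{banach, real_normed_algebra}"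
  assumes "continuous_on (sphere 0 1) f"
  shows "circle_mean (\<lambda>z. c * f z) = c * circle_mean f"
  by (rule circle_mean_bounded_linear[OF bounded_linear_mult_right assms])

lemma circle_mean_mono:
  fixes f g :: "complex \<Rightarrow> real"
  assumes "continuous_on (sphere 0 1) f" "continuous_on (sphere 0 1) g"
    and "\<And>z. cmod z = 1 \<Longrightarrow> f z \<le> g z"
  shows "circle_mean f \<le> circle_mean g"
  unfolding circle_mean_def
  by (intro scaleR_left_mono integral_le integrable_circle_cis assms) auto

lemma norm_circle_mean_le:
  assumes "continuous_on (sphere 0 1) f"
  shows "norm (circle_mean f) \<le> circle_mean (\<lambda>z. norm (f z))"
  unfolding circle_mean_def norm_scaleR real_scaleR_def
  by (intro mult_mono integral_norm_bound_integral integrable_circle_cis continuous_on_norm assms) auto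

lemma circle_mean_cong:
  "(\<And>z. cmod z = 1 \<Longrightarrow> f z = g z) \<Longrightarrow> circle_mean f = circle_mean g"
  by (simp add: circle_mean_def)

lemma circle_mean_tendsto:
  fixes f :: "'b \<Rightarrow> complex \<Rightarrow> 'a::banach"
  assumes "uniform_limit (sphere 0 1) f g F" "F \<noteq> bot"
    and "\<And>n. continuous_on (sphere 0 1) (f n)"
  shows "((\<lambda>n. circle_mean (f n)) \<longlongrightarrow> circle_mean g) F"
proof -
  have "uniform_limit {0..2*pi} (\<lambda>n t. f n (cis t)) (\<lambda>t. g (cis t)) F"
    using uniform_limit_compose'[OF assms(1), of cis "{0..2*pi}"] by auto
  then obtain I J where IJ: "\<And>n. ((\<lambda>t. f n (cis t)) has_integral I n) {0..2*pi}"
    "((\<lambda>t. g (cis t)) has_integral J) {0..2*pi}" "(I \<longlongrightarrow> J) F"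
    by (rule uniform_limit_integral) (use assms(2) in \<open>auto intro: continuous_on_circle_cis assms(3)\<close>)
  then show ?thesis
    unfolding circle_mean_def using integral_unique[OF IJ(1)] integral_unique[OF IJ(2)]
    by (auto intro!: tendsto_intros)
qed

lemma circle_mean_Cauchy_formula:
  assumes "continuous_on (cball 0 1) h" "h holomorphic_on ball 0 1" "cmod z < 1"
  shows "circle_mean (\<lambda>\<zeta>. \<zeta> / (\<zeta> - z) * h \<zeta>) = h z"
proof -
  have "((\<lambda>\<zeta>. h \<zeta> / (\<zeta> - z)) has_contour_integral (2 * of_real pi * \<i> * h z)) (circlepath 0 1)"
    by (rule Cauchy_integral_circlepath) (use assms in auto)
  then have "((\<lambda>t. h (cis t) / (cis t - z) * \<i> * cis t) has_integral (2 * of_real pi * \<i> * h z)) {0..2*pi}"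
    unfolding circlepath_def using has_contour_integral_part_circlepath_iff[of 0 "2*pi"] by simp
  from has_integral_divide[OF this, of \<i>]
  have "((\<lambda>t. cis t / (cis t - z) * h (cis t)) has_integral (2 * of_real pi * h z)) {0..2*pi}"
    by (simp add: mult_ac)
  then show ?thesis
    by (simp add: circle_mean_def integral_unique scaleR_conv_of_real)
qed

lemma circle_mean_holomorphic:
  assumes "continuous_on (cball 0 1) h" "h holomorphic_on ball 0 1"
  shows "circle_mean h = h 0"
proof -
  have "circle_mean h = circle_mean (\<lambda>\<zeta>. \<zeta> / (\<zeta> - 0) * h \<zeta>)"
    by (rule circle_mean_cong) auto
  also have "\<dots> = h 0"
    by (rule circle_mean_Cauchy_formula[OF assms]) simp
  finally show ?thesis .
qed

lemma circle_mean_Re_holomorphic: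
  assumes "continuous_on (cball 0 1) h" "h holomorphic_on ball 0 1"
  shows "circle_mean (\<lambda>z. Re (h z)) = Re (h 0)"
  using circle_mean_bounded_linear[OF bounded_linear_Re, of h] circle_mean_holomorphic[OF assms]
    continuous_on_subset[OF assms(1)] by (simp add: sphere_cball)

definition poisson_kernel :: "complex \<Rightarrow> complex \<Rightarrow> real" where
  "poisson_kernel z \<zeta> = (1 - (cmod z)\<^sup>2) / (cmod (\<zeta> - z))\<^sup>2"

definition poisson_integral :: "(complex \<Rightarrow> real) \<Rightarrow> complex \<Rightarrow> real" where
  "poisson_integral g z = circle_mean (\<lambda>\<zeta>. poisson_kernel z \<zeta> * g \<zeta>)"

lemma continuous_on_poisson_kernel:
  assumes "cmod z < 1"
  shows "continuous_on (sphere 0 1) (poisson_kernel z)"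
  unfolding poisson_kernel_def[abs_def]
  by (intro continuous_intros) (use assms in auto)

definition harnack_const :: "complex \<Rightarrow> real" where
  "harnack_const z = (1 + cmod z) / (1 - cmod z)"

lemma harnack_const_pos: "cmod z < 1 \<Longrightarrow> 0 < harnack_const z"
  by (simp add: harnack_const_def add_pos_nonneg)

lemma poisson_kernel_bounds:
  assumes "cmod z < 1" "cmod \<zeta> = 1"
  shows "inverse (harnack_const z) \<le> poisson_kernel z \<zeta>"
    and "poisson_kernel z \<zeta> \<le> harnack_const z"
proof -
  define r where "r = cmod z"
  have r: "0 \<le> r" "r < 1" using assms by (auto simp: r_def)
  have dist: "1 - r \<le> cmod (\<zeta> - z)" "cmod (\<zeta> - z) \<le> 1 + r"
    using assms norm_triangle_ineq2[of \<zeta> z] norm_triangle_ineq4[of \<zeta> z] by (auto simp: r_def)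
  have fraction: "inverse (harnack_const z) = (1 - r\<^sup>2) / (1 + r)\<^sup>2" "harnack_const z = (1 - r\<^sup>2) / (1 - r)\<^sup>2"
    using r by (simp_all add: harnack_const_def r_def[symmetric] divide_simps)
      (simp_all add: power2_eq_square algebra_simps)
  have "0 \<le> 1 - r\<^sup>2" using r by (simp add: power_le_one)
  with r dist show "inverse (harnack_const z) \<le> poisson_kernel z \<zeta>"
    unfolding poisson_kernel_def r_def[symmetric] fraction(1)
    by (intro divide_left_mono power_mono mult_pos_pos zero_less_power) auto
  from \<open>0 \<le> 1 - r\<^sup>2\<close> r dist show "poisson_kernel z \<zeta> \<le> harnack_const z"
    unfolding poisson_kernel_def r_def[symmetric] fraction(2)
    by (intro divide_left_mono power_mono mult_pos_pos zero_less_power) auto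
qed

lemma poisson_kernel_nonneg: "cmod z < 1 \<Longrightarrow> 0 \<le> poisson_kernel z \<zeta>"
  by (simp add: poisson_kernel_def power_le_one)

lemma poisson_kernel_eq_cnj:
  assumes "cmod z < 1" "cmod \<zeta> = 1"
  shows "of_real (poisson_kernel z \<zeta>) = \<zeta> / (\<zeta> - z) * (of_real (1 - (cmod z)\<^sup>2) / (1 - cnj z * \<zeta>))"
proof -
  have "1 - cnj z * \<zeta> = \<zeta> * cnj (\<zeta> - z)"
    using assms(2) complex_norm_square[of \<zeta>] by (simp add: algebra_simps)
  moreover have "\<zeta> \<noteq> 0" "\<zeta> \<noteq> z" using assms by auto
  ultimately show ?thesis
    by (simp add: poisson_kernel_def complex_norm_square del: of_real_power of_real_diff complex_cnj_diff)
qed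

lemma one_minus_cnj_mult_nonzero:
  assumes "cmod z < 1" "cmod \<zeta> \<le> 1"
  shows "1 - cnj z * \<zeta> \<noteq> 0"
proof
  assume "1 - cnj z * \<zeta> = 0"
  then have "cmod (cnj z * \<zeta>) = 1" by simp
  moreover have "cmod z * cmod \<zeta> \<le> cmod z * 1" using assms by (intro mult_left_mono) auto
  ultimately show False using assms by (simp add: norm_mult)
qed

text \<open>Cauchy's formula for \<open>(1 - \<bar>z\<bar>\<^sup>2) h(\<zeta>) / (1 - cnj z \<zeta>)\<close>, which takes the value \<open>h z\<close> at \<open>z\<close>.\<close>

lemma poisson_formula:
  assumes h: "continuous_on (cball 0 1) h" "h holomorphic_on ball 0 1" and z: "cmod z < 1"
  shows "circle_mean (\<lambda>\<zeta>. of_real (poisson_kernel z \<zeta>) * h \<zeta>) = h z"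
proof -
  define g where "g \<zeta> = of_real (1 - (cmod z)\<^sup>2) / (1 - cnj z * \<zeta>) * h \<zeta>" for \<zeta>
  have nonzero: "cnj z * \<zeta> \<noteq> 1" if "cmod \<zeta> \<le> 1" for \<zeta>
    using one_minus_cnj_mult_nonzero[OF z that] by simp
  have "circle_mean (\<lambda>\<zeta>. of_real (poisson_kernel z \<zeta>) * h \<zeta>) = circle_mean (\<lambda>\<zeta>. \<zeta> / (\<zeta> - z) * g \<zeta>)"
    by (rule circle_mean_cong) (simp add: poisson_kernel_eq_cnj[OF z] g_def del: of_real_diff)
  also have "\<dots> = g z"
    unfolding g_def by (rule circle_mean_Cauchy_formula[OF _ _ z])
      (auto intro!: continuous_intros holomorphic_intros h simp: nonzero)
  also have "\<dots> = h z"
    using one_minus_cnj_mult_nonzero[OF z less_imp_le[OF z]] complex_norm_square[of z]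
    by (simp add: g_def mult.commute)
  finally show ?thesis .
qed

lemma poisson_integral_Re:
  assumes "continuous_on (cball 0 1) h" "h holomorphic_on ball 0 1" "cmod z < 1"
  shows "poisson_integral (\<lambda>\<zeta>. Re (h \<zeta>)) z = Re (h z)"
proof -
  have "continuous_on (sphere 0 1) h" by (rule continuous_on_subset[OF assms(1)]) auto
  then have "circle_mean (\<lambda>\<zeta>. Re (of_real (poisson_kernel z \<zeta>) * h \<zeta>)) = Re (h z)"
    by (subst circle_mean_bounded_linear[OF bounded_linear_Re])
       (auto intro!: continuous_intros continuous_on_poisson_kernel simp: assms poisson_formula)
  then show ?thesis by (simp add: poisson_integral_def)
qed

lemma poisson_integral_const: "cmod z < 1 \<Longrightarrow> poisson_integral (\<lambda>_. c) z = c"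
  using poisson_integral_Re[of "\<lambda>_. of_real c" z] by simp

lemma cmod_square_le_poisson_integral:
  assumes h: "continuous_on (cball 0 1) h" "h holomorphic_on ball 0 1" and z: "cmod z < 1"
  shows "(cmod (h z))\<^sup>2 \<le> poisson_integral (\<lambda>\<zeta>. (cmod (h \<zeta>))\<^sup>2) z"
proof -
  have cont: "continuous_on (sphere 0 1) h" by (rule continuous_on_subset[OF h(1)]) auto
  have "(cmod (h z))\<^sup>2 = cmod (circle_mean (\<lambda>\<zeta>. of_real (poisson_kernel z \<zeta>) * (h \<zeta>)\<^sup>2))"
    by (subst poisson_formula[OF _ _ z])
       (auto intro!: continuous_intros holomorphic_intros h simp: norm_power)
  also have "\<dots> \<le> circle_mean (\<lambda>\<zeta>. cmod (of_real (poisson_kernel z \<zeta>) * (h \<zeta>)\<^sup>2))"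
    by (intro norm_circle_mean_le continuous_intros continuous_on_poisson_kernel z cont)
  also have "\<dots> = poisson_integral (\<lambda>\<zeta>. (cmod (h \<zeta>))\<^sup>2) z"
    by (simp add: poisson_integral_def norm_mult norm_power poisson_kernel_nonneg[OF z])
  finally show ?thesis .
qed

lemma harnack_inequality:
  assumes z: "cmod z < 1" and g: "continuous_on (sphere 0 1) g" "\<And>\<zeta>. cmod \<zeta> = 1 \<Longrightarrow> 0 \<le> g \<zeta>"
  shows "inverse (harnack_const z) * circle_mean g \<le> poisson_integral g z"
    and "poisson_integral g z \<le> harnack_const z * circle_mean g"
  unfolding poisson_integral_def circle_mean_mult_left[OF g(1), symmetric]
  by (rule circle_mean_mono; intro continuous_intros continuous_on_poisson_kernel mult_right_mono
      poisson_kernel_bounds g z; simp)+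

section \<open>Square means and Parseval's identity\<close>

lemma continuous_on_sphere_scale:
  fixes f :: "complex \<Rightarrow> 'a::topological_space"
  assumes "continuous_on (sphere 0 r) f" "0 \<le> r"
  shows "continuous_on (sphere 0 1) (\<lambda>z. f (of_real r * z))"
  by (rule continuous_on_compose2[OF assms(1), of _ "\<lambda>z. of_real r * z :: complex"])
     (use assms(2) in \<open>auto intro!: continuous_intros simp: norm_mult\<close>)

lemma h2_mean_eq_circle_mean:
  assumes "continuous_on (sphere 0 r) f" "0 \<le> r"
  shows "h2_mean f r = circle_mean (\<lambda>z. (cmod (f (of_real r * z)))\<^sup>2)"
proof -
  have "continuous_on (sphere 0 1) (\<lambda>z. (cmod (f (of_real r * z)))\<^sup>2)"
    by (intro continuous_intros continuous_on_sphere_scale assms)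
  then have "set_integrable lborel {0..2*pi} (\<lambda>t. (cmod (f (of_real r * cis t)))\<^sup>2)"
    by (intro borel_integrable_atLeastAtMost') (rule continuous_on_circle_cis)
  then show ?thesis
    by (simp add: h2_mean_def circle_mean_def set_borel_integral_eq_integral(2))
qed

lemma h2_mean_nonneg: "0 \<le> h2_mean f r"
  unfolding h2_mean_def set_lebesgue_integral_def by (intro mult_nonneg_nonneg integral_nonneg_AE) auto

lemma h2_mean_cong:
  assumes "\<And>z. cmod z = r \<Longrightarrow> f z = g z" "0 \<le> r"
  shows "h2_mean f r = h2_mean g r"
  using assms by (simp add: h2_mean_def norm_mult)

lemma h2_mean_const [simp]: "h2_mean (\<lambda>_. c) r = (cmod c)\<^sup>2"
  by (simp add: h2_mean_def set_lebesgue_integral_def)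

lemma h2_mean_dilate: "h2_mean (\<lambda>z. f (of_real s * z)) r = h2_mean f (s * r)"
  by (simp add: h2_mean_def mult.assoc)

lemma h2_mean_le_linear:
  assumes cont: "continuous_on (sphere 0 r) f" "continuous_on (sphere 0 r) g" "continuous_on (sphere 0 r) h"
    and le: "\<And>z. cmod z = r \<Longrightarrow> (cmod (f z))\<^sup>2 \<le> a * (cmod (g z))\<^sup>2 + b * (cmod (h z))\<^sup>2" and r: "0 \<le> r"
  shows "h2_mean f r \<le> a * h2_mean g r + b * h2_mean h r"
proof -
  note scaled = cont[THEN continuous_on_sphere_scale, OF r]
  have "h2_mean f r \<le> circle_mean (\<lambda>z. a * (cmod (g (of_real r * z)))\<^sup>2 + b * (cmod (h (of_real r * z)))\<^sup>2)"
    unfolding h2_mean_eq_circle_mean[OF cont(1) r]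
    by (intro circle_mean_mono continuous_intros scaled le) (use r in \<open>simp add: norm_mult\<close>)
  also have "\<dots> = a * h2_mean g r + b * h2_mean h r"
    unfolding h2_mean_eq_circle_mean[OF cont(2) r] h2_mean_eq_circle_mean[OF cont(3) r]
    by (simp add: circle_mean_add circle_mean_mult_left continuous_on_mult_left continuous_on_power
        continuous_on_norm scaled)
  finally show ?thesis .
qed

lemma uniform_limit_cmod_square:
  assumes "uniform_limit S f g F" "bounded (g ` S)"
  shows "uniform_limit S (\<lambda>n z. (cmod (f n z))\<^sup>2) (\<lambda>z. (cmod (g z))\<^sup>2) F"
  unfolding power2_eq_square
  by (intro uniform_lim_mult uniform_limit_norm assms) (use assms(2) in \<open>simp_all add: bounded_norm_comp\<close>)

lemma h2_mean_tendsto: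
  assumes "uniform_limit (sphere 0 r) f g F" "F \<noteq> bot"
    and "\<And>n. continuous_on (sphere 0 r) (f n)" and "0 \<le> r"
  shows "((\<lambda>n. h2_mean (f n) r) \<longlongrightarrow> h2_mean g r) F"
proof -
  have g: "continuous_on (sphere 0 r) g"
    using assms by (intro uniform_limit_theorem[OF _ assms(1)]) auto
  have "uniform_limit (sphere 0 1) (\<lambda>n z. f n (of_real r * z)) (\<lambda>z. g (of_real r * z)) F"
    by (rule uniform_limit_compose'[OF assms(1)]) (use \<open>0 \<le> r\<close> in \<open>auto simp: norm_mult\<close>)
  then have "uniform_limit (sphere 0 1) (\<lambda>n z. (cmod (f n (of_real r * z)))\<^sup>2)
      (\<lambda>z. (cmod (g (of_real r * z)))\<^sup>2) F"
    by (rule uniform_limit_cmod_square)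
       (intro compact_imp_bounded compact_continuous_image continuous_on_sphere_scale g assms compact_sphere)
  then show ?thesis
    unfolding h2_mean_eq_circle_mean[OF g \<open>0 \<le> r\<close>] h2_mean_eq_circle_mean[OF assms(3) \<open>0 \<le> r\<close>]
    by (intro circle_mean_tendsto continuous_intros continuous_on_sphere_scale assms)
qed

lemma cmod_add_square: "(cmod (a + b))\<^sup>2 = (cmod a)\<^sup>2 + 2 * Re (cnj a * b) + (cmod b)\<^sup>2"
  by (simp only: cmod_power2 plus_complex.sel times_complex.sel cnj.sel) algebra

lemma holomorphic_on_subset_cball:
  assumes "f holomorphic_on ball 0 R" "r < R" "S \<subseteq> cball 0 r"
  shows "f holomorphic_on S" "continuous_on S f"
proof -
  show "f holomorphic_on S" by (rule holomorphic_on_subset[OF assms(1)]) (use assms(2,3) in force)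
  then show "continuous_on S f" by (rule holomorphic_on_imp_continuous_on)
qed

lemma dilate_in_ball:
  assumes "0 \<le> s" "s < 1" "z \<in> cball 0 1"
  shows "complex_of_real s * z \<in> ball 0 1"
  using assms mult_left_mono[of "cmod z" 1 s] by (simp add: norm_mult)

lemma holomorphic_on_dilate:
  assumes "f holomorphic_on ball 0 R" "0 \<le> s" "s < R"
  obtains T where "1 < T" "(\<lambda>z. f (of_real s * z)) holomorphic_on ball 0 T"
proof
  show "1 < 2 * R / (R + s)" using assms by (simp add: field_simps)
  have "of_real s * z \<in> ball 0 R" if "z \<in> ball 0 (2 * R / (R + s))" for z :: complex
  proof -
    have "s * cmod z \<le> s * (2 * R / (R + s))" using assms that by (intro mult_left_mono) auto
    also have "\<dots> < R" using assms by (simp add: field_simps)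
    finally show ?thesis using assms by (simp add: norm_mult)
  qed
  then show "(\<lambda>z. f (of_real s * z)) holomorphic_on ball 0 (2 * R / (R + s))"
    by (intro holomorphic_on_compose_gen[OF _ assms(1), unfolded o_def] holomorphic_intros) auto
qed

lemma h2_mean_const_add:
  assumes f: "f holomorphic_on ball 0 R" "f 0 = 0" and r: "0 \<le> r" "r < R"
  shows "h2_mean (\<lambda>z. a + f z) r = (cmod a)\<^sup>2 + h2_mean f r"
proof -
  define F where "F z = f (of_real r * z)" for z
  obtain T where T: "1 < T" "F holomorphic_on ball 0 T"
    using holomorphic_on_dilate[OF f(1) r] unfolding F_def .
  have cont_sphere: "continuous_on (sphere 0 r) f"
    by (rule holomorphic_on_subset_cball(2)[OF f(1) r(2) sphere_cball])
  note hol = holomorphic_on_subset_cball(1)[OF T(2,1)]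
  have cont: "continuous_on (cball 0 1) F" "continuous_on (sphere 0 1) F"
    by (rule holomorphic_on_subset_cball(2)[OF T(2,1)], simp)+
  have "circle_mean (\<lambda>z. Re (cnj a * F z)) = Re (cnj a * F 0)"
    by (intro circle_mean_Re_holomorphic continuous_intros holomorphic_intros cont hol) auto
  then have cross: "circle_mean (\<lambda>z. Re (cnj a * F z)) = 0" using f(2) by (simp add: F_def)
  have "h2_mean (\<lambda>z. a + f z) r = circle_mean (\<lambda>z. (cmod a)\<^sup>2 + (2 * Re (cnj a * F z) + (cmod (F z))\<^sup>2))"
    using r by (simp add: h2_mean_eq_circle_mean continuous_on_add cont_sphere F_def[symmetric]
        cmod_add_square add.assoc mult.assoc del: times_complex.sel)
  also have "\<dots> = (cmod a)\<^sup>2 + h2_mean f r"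
    using r cross by (simp add: h2_mean_eq_circle_mean cont_sphere F_def[symmetric] circle_mean_add
        circle_mean_mult_left continuous_on_add continuous_on_power continuous_on_norm continuous_on_Re
        continuous_on_mult_left cont add.assoc mult.assoc del: times_complex.sel)
  finally show ?thesis .
qed

lemma h2_mean_mult_ident:
  assumes "0 \<le> r"
  shows "h2_mean (\<lambda>z. z * f z) r = r\<^sup>2 * h2_mean f r"
  using assms by (simp add: h2_mean_def norm_mult power_mult_distrib set_lebesgue_integral_def
      mult.left_commute[of "indicator _ _"])

lemma sum_power_Suc_shift:
  fixes z :: "'a::comm_semiring_1"
  shows "(\<Sum>i<Suc n. a i * z ^ i) = a 0 + z * (\<Sum>i<n. a (Suc i) * z ^ i)"
  by (subst sum.lessThan_Suc_shift) (simp add: sum_distrib_left mult_ac)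

lemma h2_mean_partial_sum:
  assumes "0 \<le> r"
  shows "h2_mean (\<lambda>z. \<Sum>i<n. a i * z ^ i) r = (\<Sum>i<n. (cmod (a i))\<^sup>2 * r ^ (2 * i))"
proof (induction n arbitrary: a)
  case 0
  show ?case by simp
next
  case (Suc n)
  have "h2_mean (\<lambda>z. a 0 + z * (\<Sum>i<n. a (Suc i) * z ^ i)) r
      = (cmod (a 0))\<^sup>2 + h2_mean (\<lambda>z. z * (\<Sum>i<n. a (Suc i) * z ^ i)) r"
    using assms by (intro h2_mean_const_add[of _ "r + 1"] holomorphic_intros) auto
  also have "h2_mean (\<lambda>z. z * (\<Sum>i<n. a (Suc i) * z ^ i)) r = r\<^sup>2 * (\<Sum>i<n. (cmod (a (Suc i)))\<^sup>2 * r ^ (2 * i))"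
    using assms by (simp add: h2_mean_mult_ident Suc.IH)
  finally show ?case
    unfolding sum_power_Suc_shift
    by (subst sum.lessThan_Suc_shift) (simp add: sum_distrib_left power2_eq_square mult_ac)
qed

lemma uniform_limit_power_series:
  fixes a :: "nat \<Rightarrow> complex"
  assumes "\<And>z. z \<in> ball 0 R \<Longrightarrow> (\<lambda>n. a n * z ^ n) sums f z" "0 \<le> r" "r < R"
  shows "uniform_limit (cball 0 r) (\<lambda>n z. \<Sum>i<n. a i * z ^ i) f sequentially"
proof -
  obtain x where x: "r < x" "x < R" using \<open>r < R\<close> dense by blast
  have "summable (\<lambda>n. a n * of_real x ^ n)"
    using assms(1)[of "of_real x"] x \<open>0 \<le> r\<close> by (auto simp: sums_iff)
  then have "ereal x \<le> conv_radius a"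
    using conv_radius_geI[of a "of_real x"] x \<open>0 \<le> r\<close> by simp
  then have "ereal r < conv_radius a"
    using x by (metis ereal_less_eq(3) less_ereal.simps(1) order_less_le_trans)
  from powser_uniform_limit[OF this, of 0]
  show ?thesis
    by (rule uniform_limit_cong'[THEN iffD1, rotated 2])
       (use assms in \<open>auto simp: sums_iff\<close>)
qed

theorem parseval_h2_mean:
  fixes a :: "nat \<Rightarrow> complex"
  assumes "\<And>z. z \<in> ball 0 R \<Longrightarrow> (\<lambda>n. a n * z ^ n) sums f z" "0 \<le> r" "r < R"
  shows "(\<lambda>n. (cmod (a n))\<^sup>2 * r ^ (2 * n)) sums h2_mean f r"
proof -
  have "uniform_limit (sphere 0 r) (\<lambda>n z. \<Sum>i<n. a i * z ^ i) f sequentially"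
    by (rule uniform_limit_on_subset[OF uniform_limit_power_series[OF assms]]) auto
  then have "(\<lambda>n. h2_mean (\<lambda>z. \<Sum>i<n. a i * z ^ i) r) \<longlonglongrightarrow> h2_mean f r"
    by (rule h2_mean_tendsto) (use \<open>0 \<le> r\<close> in \<open>auto intro!: continuous_intros\<close>)
  then show ?thesis
    by (simp add: sums_def h2_mean_partial_sum[OF \<open>0 \<le> r\<close>])
qed

definition taylor_coeff :: "(complex \<Rightarrow> complex) \<Rightarrow> nat \<Rightarrow> complex" where
  "taylor_coeff f n = (deriv ^^ n) f 0 / fact n"

lemma taylor_sums:
  assumes "f holomorphic_on ball 0 R" "z \<in> ball 0 R"
  shows "(\<lambda>n. taylor_coeff f n * z ^ n) sums f z"
  using holomorphic_power_series[OF assms] by (simp add: taylor_coeff_def)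

lemma h2_mean_mono:
  assumes "f holomorphic_on ball 0 R" "0 \<le> r" "r \<le> s" "s < R"
  shows "h2_mean f r \<le> h2_mean f s"
proof (rule sums_le)
  show "(\<lambda>n. (cmod (taylor_coeff f n))\<^sup>2 * r ^ (2 * n)) sums h2_mean f r"
    "(\<lambda>n. (cmod (taylor_coeff f n))\<^sup>2 * s ^ (2 * n)) sums h2_mean f s"
    using assms by (auto intro!: parseval_h2_mean taylor_sums[OF assms(1)])
qed (use assms in \<open>auto intro!: mult_left_mono power_mono\<close>)

text \<open>In terms of coefficients this is \<open>(1 - \<rho>\<^sup>n)\<^sup>2 \<le> 1 - \<rho>\<^bsup>2n\<^esup>\<close>.\<close>

lemma h2_mean_diff_dilate_le:
  assumes f: "f holomorphic_on ball 0 R" and s: "0 \<le> s" "s < R" and \<rho>: "0 \<le> \<rho>" "\<rho> \<le> 1"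
  shows "h2_mean (\<lambda>z. f z - f (of_real \<rho> * z)) s \<le> h2_mean f s - h2_mean f (\<rho> * s)"
proof -
  define a where "a = taylor_coeff f"
  have sums: "(\<lambda>n. a n * z ^ n) sums f z" if "z \<in> ball 0 R" for z
    unfolding a_def by (rule taylor_sums[OF f that])
  have "of_real \<rho> * z \<in> ball 0 R" if "z \<in> ball 0 R" for z :: complex
    using \<rho> that mult_right_mono[of \<rho> 1 "cmod z"] by (simp add: norm_mult)
  then have diff: "(\<lambda>n. (a n * of_real (1 - \<rho> ^ n)) * z ^ n) sums (f z - f (of_real \<rho> * z))"
    if "z \<in> ball 0 R" for z
    using sums_diff[OF sums[OF that] sums[of "of_real \<rho> * z"]] that
    by (simp add: power_mult_distrib algebra_simps)
  have "\<rho> * s < R" using s \<rho> mult_right_mono[of \<rho> 1 s] by simp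
  then have mean_scaled: "(\<lambda>n. (cmod (a n))\<^sup>2 * (\<rho> * s) ^ (2 * n)) sums h2_mean f (\<rho> * s)"
    using s \<rho> by (intro parseval_h2_mean[where R = R] sums) auto
  have mean: "(\<lambda>n. (cmod (a n))\<^sup>2 * s ^ (2 * n)) sums h2_mean f s"
    and mean_diff: "(\<lambda>n. (cmod (a n * of_real (1 - \<rho> ^ n)))\<^sup>2 * s ^ (2 * n))
      sums h2_mean (\<lambda>z. f z - f (of_real \<rho> * z)) s"
    using s by (auto intro!: parseval_h2_mean[where R = R] sums diff simp del: of_real_diff)
  show ?thesis
  proof (rule sums_le[OF _ mean_diff sums_diff[OF mean mean_scaled]])
    fix n
    have \<rho>n: "0 \<le> \<rho> ^ n" "\<rho> ^ n \<le> 1" using \<rho> by (auto simp: power_le_one)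
    have "(1 - \<rho> ^ n)\<^sup>2 \<le> (1 - \<rho> ^ n) * (1 + \<rho> ^ n)"
      unfolding power2_eq_square using \<rho>n by (intro mult_left_mono) auto
    also have "\<dots> = 1 - \<rho> ^ (2 * n)"
      by (simp add: left_diff_distrib distrib_left power_even_eq power2_eq_square)
    finally have "((cmod (a n))\<^sup>2 * s ^ (2 * n)) * (1 - \<rho> ^ n)\<^sup>2
        \<le> ((cmod (a n))\<^sup>2 * s ^ (2 * n)) * (1 - \<rho> ^ (2 * n))"
      using s by (intro mult_left_mono) auto
    then show "(cmod (a n * of_real (1 - \<rho> ^ n)))\<^sup>2 * s ^ (2 * n)
        \<le> (cmod (a n))\<^sup>2 * s ^ (2 * n) - (cmod (a n))\<^sup>2 * (\<rho> * s) ^ (2 * n)"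
      by (simp add: norm_mult power_mult_distrib right_diff_distrib mult_ac del: of_real_diff)
  qed
qed

section \<open>The Hardy space\<close>

lemma H2_holomorphic: "f \<in> H2 \<Longrightarrow> f holomorphic_on ball 0 1"
  by (simp add: H2_def)

lemma H2_isCont: "f \<in> H2 \<Longrightarrow> z \<in> ball 0 1 \<Longrightarrow> isCont f z"
  using holomorphic_on_imp_continuous_on[OF H2_holomorphic] by (auto simp: continuous_on_eq_continuous_at)

lemma eventually_unit_interval_at_left: "eventually (\<lambda>s::real. s \<in> {0<..<1}) (at_left 1)"
  by (intro eventually_at_left_real) simp

lemma H2I:
  assumes "f holomorphic_on ball 0 1" "\<And>s. 0 \<le> s \<Longrightarrow> s < 1 \<Longrightarrow> h2_mean f s \<le> B"
  shows "f \<in> H2"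
  using assms by (auto simp: H2_def intro!: bdd_aboveI[of _ B])

lemma h2_norm_square:
  assumes "f \<in> H2"
  shows "(h2_norm f)\<^sup>2 = (SUP s\<in>{0..<1}. h2_mean f s)"
proof -
  have "0 \<le> (SUP s\<in>{0..<1}. h2_mean f s)"
    using assms by (intro cSUP_upper2[where x = 0] h2_mean_nonneg) (auto simp: H2_def)
  then show ?thesis by (simp add: h2_norm_def)
qed

lemma h2_norm_nonneg: "f \<in> H2 \<Longrightarrow> 0 \<le> h2_norm f"
  unfolding h2_norm_def H2_def
  by (auto intro!: real_sqrt_ge_zero cSUP_upper2[where x = 0] h2_mean_nonneg)

lemma h2_mean_le_norm:
  assumes "f \<in> H2" "0 \<le> s" "s < 1"
  shows "h2_mean f s \<le> (h2_norm f)\<^sup>2"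
  unfolding h2_norm_square[OF assms(1)] using assms by (intro cSUP_upper) (auto simp: H2_def)

lemma h2_norm_square_le:
  assumes "f \<in> H2" "\<And>s. 0 \<le> s \<Longrightarrow> s < 1 \<Longrightarrow> h2_mean f s \<le> B"
  shows "(h2_norm f)\<^sup>2 \<le> B"
  unfolding h2_norm_square[OF assms(1)] using assms(2) by (intro cSUP_least) auto

lemma h2_mean_tendsto_norm:
  assumes "f \<in> H2"
  shows "(h2_mean f \<longlongrightarrow> (h2_norm f)\<^sup>2) (at_left 1)"
proof (rule order_tendstoI)
  fix a assume "a < (h2_norm f)\<^sup>2"
  then have "\<exists>s0\<in>{0..<1}. a < h2_mean f s0"
    unfolding h2_norm_square[OF assms] using assms by (subst (asm) less_cSUP_iff) (auto simp: H2_def)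
  then obtain s0 where s0: "0 \<le> s0" "s0 < 1" "a < h2_mean f s0" by auto
  from eventually_at_left_real[OF s0(2)] show "eventually (\<lambda>s. a < h2_mean f s) (at_left 1)"
  proof eventually_elim
    case (elim s)
    then show ?case using h2_mean_mono[OF H2_holomorphic[OF assms], of s0 s] s0 by auto
  qed
next
  fix a assume a: "(h2_norm f)\<^sup>2 < a"
  show "eventually (\<lambda>s. h2_mean f s < a) (at_left 1)"
    using eventually_unit_interval_at_left
  proof eventually_elim
    case (elim s)
    then show ?case using h2_mean_le_norm[OF assms, of s] a by auto
  qed
qed

lemma H2_const: "(\<lambda>_. c) \<in> H2"
  by (rule H2I[where B = "(cmod c)\<^sup>2"]) auto

lemma h2_norm_const: "h2_norm (\<lambda>_. c) = cmod c"
  by (simp add: h2_norm_def)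

lemma H2_dominated:
  assumes f: "f holomorphic_on ball 0 1" and g: "g \<in> H2" and h: "h \<in> H2"
    and le: "\<And>z. cmod z < 1 \<Longrightarrow> (cmod (f z))\<^sup>2 \<le> a * (cmod (g z))\<^sup>2 + b * (cmod (h z))\<^sup>2"
    and "0 \<le> a" "0 \<le> b"
  shows "f \<in> H2" "(h2_norm f)\<^sup>2 \<le> a * (h2_norm g)\<^sup>2 + b * (h2_norm h)\<^sup>2"
proof -
  have mean: "h2_mean f s \<le> a * (h2_norm g)\<^sup>2 + b * (h2_norm h)\<^sup>2" if s: "0 \<le> s" "s < 1" for s
  proof -
    note sphere = holomorphic_on_subset_cball(2)[OF _ s(2) sphere_cball]
    note cont = sphere[OF f] sphere[OF H2_holomorphic[OF g]] sphere[OF H2_holomorphic[OF h]]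
    have "h2_mean f s \<le> a * h2_mean g s + b * h2_mean h s"
      by (rule h2_mean_le_linear[OF cont le s(1)]) (use s in simp)
    also have "\<dots> \<le> a * (h2_norm g)\<^sup>2 + b * (h2_norm h)\<^sup>2"
      by (intro add_mono mult_left_mono h2_mean_le_norm assms s)
    finally show ?thesis .
  qed
  show "f \<in> H2" by (rule H2I[OF f mean])
  then show "(h2_norm f)\<^sup>2 \<le> a * (h2_norm g)\<^sup>2 + b * (h2_norm h)\<^sup>2"
    by (rule h2_norm_square_le) (rule mean)
qed

lemma H2_mult_bounded:
  assumes "b holomorphic_on ball 0 1" "b ` ball 0 1 \<subseteq> cball 0 1" "f \<in> H2"
  shows "(\<lambda>z. b z * f z) \<in> H2" "h2_norm (\<lambda>z. b z * f z) \<le> h2_norm f"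
proof -
  have le: "(cmod (b z * f z))\<^sup>2 \<le> 1 * (cmod (f z))\<^sup>2 + 0 * (cmod 0)\<^sup>2" if "cmod z < 1" for z
    using assms(2) that
    by (auto simp: norm_mult power_mult_distrib image_subset_iff intro!: mult_left_le_one_le power_le_one)
  have "(\<lambda>z. b z * f z) holomorphic_on ball 0 1"
    by (intro holomorphic_intros assms H2_holomorphic)
  note dominated = H2_dominated[OF this assms(3) H2_const le]
  show "(\<lambda>z. b z * f z) \<in> H2" using dominated(1) by simp
  have "(h2_norm (\<lambda>z. b z * f z))\<^sup>2 \<le> (h2_norm f)\<^sup>2" using dominated(2) by simp
  then show "h2_norm (\<lambda>z. b z * f z) \<le> h2_norm f"
    using h2_norm_nonneg[OF assms(3)] by (rule power2_le_imp_le)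
qed

lemma H2_bounded:
  assumes "f holomorphic_on ball 0 1" "f ` ball 0 1 \<subseteq> cball 0 1"
  shows "f \<in> H2" "h2_norm f \<le> 1"
  using H2_mult_bounded[OF assms H2_const[of 1]] by (auto simp: h2_norm_const)

lemma bounded_by_1_power:
  assumes "f holomorphic_on ball 0 1" "f ` ball 0 1 \<subseteq> cball 0 1"
  shows "(\<lambda>z. f z ^ k) holomorphic_on ball 0 1" "(\<lambda>z. f z ^ k) ` ball 0 1 \<subseteq> cball 0 1"
  using assms by (auto intro!: holomorphic_intros simp: image_subset_iff norm_power power_le_one)

lemma H2_diff:
  assumes "f \<in> H2" "g \<in> H2"
  shows "(\<lambda>z. f z - g z) \<in> H2" "(h2_norm (\<lambda>z. f z - g z))\<^sup>2 \<le> 2 * (h2_norm f)\<^sup>2 + 2 * (h2_norm g)\<^sup>2"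
proof -
  have le: "(cmod (f z - g z))\<^sup>2 \<le> 2 * (cmod (f z))\<^sup>2 + 2 * (cmod (g z))\<^sup>2" for z
  proof -
    have "(cmod (f z - g z))\<^sup>2 \<le> (cmod (f z) + cmod (g z))\<^sup>2"
      by (intro power_mono norm_triangle_ineq4) auto
    also have "\<dots> \<le> 2 * (cmod (f z))\<^sup>2 + 2 * (cmod (g z))\<^sup>2"
      using sum_squares_bound[of "cmod (f z)" "cmod (g z)"] by (simp add: power2_sum)
    finally show ?thesis .
  qed
  have "(\<lambda>z. f z - g z) holomorphic_on ball 0 1"
    by (intro holomorphic_intros H2_holomorphic assms)
  from H2_dominated[OF this assms le]
  show "(\<lambda>z. f z - g z) \<in> H2" "(h2_norm (\<lambda>z. f z - g z))\<^sup>2 \<le> 2 * (h2_norm f)\<^sup>2 + 2 * (h2_norm g)\<^sup>2"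
    by auto
qed

lemma H2_dilate:
  assumes "f \<in> H2" "0 \<le> \<rho>" "\<rho> < 1"
  shows "(\<lambda>z. f (of_real \<rho> * z)) \<in> H2"
proof (rule H2I)
  obtain T where T: "1 < T" "(\<lambda>z. f (of_real \<rho> * z)) holomorphic_on ball 0 T"
    by (rule holomorphic_on_dilate[OF H2_holomorphic[OF assms(1)] assms(2,3)])
  show "(\<lambda>z. f (of_real \<rho> * z)) holomorphic_on ball 0 1"
    by (rule holomorphic_on_subset_cball(1)[OF T(2,1) ball_subset_cball])
  show "h2_mean (\<lambda>z. f (of_real \<rho> * z)) s \<le> (h2_norm f)\<^sup>2" if "0 \<le> s" "s < 1" for s
    unfolding h2_mean_dilate
    using assms that mult_strict_mono[of \<rho> 1 s 1] by (intro h2_mean_le_norm) auto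
qed

lemma h2_norm_diff_dilate_le:
  assumes f: "f \<in> H2" and \<rho>: "0 \<le> \<rho>" "\<rho> < 1"
  shows "(h2_norm (\<lambda>z. f z - f (of_real \<rho> * z)))\<^sup>2 \<le> (h2_norm f)\<^sup>2 - h2_mean f (\<rho>\<^sup>2)"
proof (rule h2_norm_square_le)
  note hol = H2_holomorphic[OF f]
  show diff: "(\<lambda>z. f z - f (of_real \<rho> * z)) \<in> H2" by (intro H2_diff H2_dilate assms)
  fix s :: real assume s: "0 \<le> s" "s < 1"
  define r where "r = max s \<rho>"
  have r: "0 \<le> r" "s \<le> r" "\<rho> \<le> r" "r < 1" using s \<rho> by (auto simp: r_def)
  have "h2_mean (\<lambda>z. f z - f (of_real \<rho> * z)) s \<le> h2_mean (\<lambda>z. f z - f (of_real \<rho> * z)) r"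
    by (rule h2_mean_mono[OF H2_holomorphic[OF diff]]) (use s r in auto)
  also have "\<dots> \<le> h2_mean f r - h2_mean f (\<rho> * r)"
    using r \<rho> by (intro h2_mean_diff_dilate_le[OF hol]) auto
  also have "\<dots> \<le> (h2_norm f)\<^sup>2 - h2_mean f (\<rho>\<^sup>2)"
  proof (intro diff_mono h2_mean_le_norm[OF f] h2_mean_mono[OF hol])
    show "\<rho>\<^sup>2 \<le> \<rho> * r" unfolding power2_eq_square using r \<rho> by (intro mult_left_mono) auto
    show "\<rho> * r < 1" using r \<rho> mult_strict_mono[of \<rho> 1 r 1] by auto
  qed (use r in auto)
  finally show "h2_mean (\<lambda>z. f z - f (of_real \<rho> * z)) s \<le> (h2_norm f)\<^sup>2 - h2_mean f (\<rho>\<^sup>2)" .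
qed

lemma h2_norm_diff_dilate_tendsto:
  assumes f: "f \<in> H2"
  shows "((\<lambda>\<rho>. h2_norm (\<lambda>z. f z - f (of_real \<rho> * z))) \<longlongrightarrow> 0) (at_left 1)"
proof -
  note unit = eventually_unit_interval_at_left
  have "((\<lambda>\<rho>::real. \<rho>\<^sup>2) \<longlongrightarrow> 1\<^sup>2) (at_left 1)" by (intro tendsto_intros)
  moreover from unit have "eventually (\<lambda>\<rho>::real. \<rho>\<^sup>2 \<in> {..<1} \<and> \<rho>\<^sup>2 \<noteq> 1) (at_left 1)"
    by eventually_elim (auto simp: abs_square_less_1 power2_eq_1_iff)
  ultimately have "filterlim (\<lambda>\<rho>::real. \<rho>\<^sup>2) (at_left 1) (at_left 1)"
    by (simp add: filterlim_at)
  then have "((\<lambda>\<rho>. h2_mean f (\<rho>\<^sup>2)) \<longlongrightarrow> (h2_norm f)\<^sup>2) (at_left 1)"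
    by (rule filterlim_compose[OF h2_mean_tendsto_norm[OF f]])
  then have "((\<lambda>\<rho>. sqrt ((h2_norm f)\<^sup>2 - h2_mean f (\<rho>\<^sup>2)))
      \<longlongrightarrow> sqrt ((h2_norm f)\<^sup>2 - (h2_norm f)\<^sup>2)) (at_left 1)"
    by (intro tendsto_intros)
  then have upper: "((\<lambda>\<rho>. sqrt ((h2_norm f)\<^sup>2 - h2_mean f (\<rho>\<^sup>2))) \<longlongrightarrow> 0) (at_left 1)" by simp
  show ?thesis
  proof (rule tendsto_sandwich[OF _ _ tendsto_const upper])
    show "eventually (\<lambda>\<rho>. 0 \<le> h2_norm (\<lambda>z. f z - f (of_real \<rho> * z))) (at_left 1)"
      using unit by eventually_elim (auto intro!: h2_norm_nonneg H2_diff H2_dilate f)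
    show "\<forall>\<^sub>F \<rho> in at_left 1.
        h2_norm (\<lambda>z. f z - f (of_real \<rho> * z)) \<le> sqrt ((h2_norm f)\<^sup>2 - h2_mean f (\<rho>\<^sup>2))"
      using unit by eventually_elim (auto intro!: real_le_rsqrt h2_norm_diff_dilate_le f)
  qed
qed

section \<open>Harmonic majorants and subordination\<close>

lemma harnack_Re:
  assumes h: "continuous_on (cball 0 1) h" "h holomorphic_on ball 0 1"
    and nonneg: "\<And>\<zeta>. cmod \<zeta> = 1 \<Longrightarrow> 0 \<le> Re (h \<zeta>)" and z: "cmod z < 1"
  shows "inverse (harnack_const z) * Re (h 0) \<le> Re (h z)"
    and "Re (h z) \<le> harnack_const z * Re (h 0)"
proof -
  have "continuous_on (sphere 0 1) (\<lambda>\<zeta>. Re (h \<zeta>))"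
    by (intro continuous_intros continuous_on_subset[OF h(1)]) auto
  from harnack_inequality[OF z this nonneg]
  show "inverse (harnack_const z) * Re (h 0) \<le> Re (h z)"
    and "Re (h z) \<le> harnack_const z * Re (h 0)"
    by (auto simp: poisson_integral_Re[OF h z] circle_mean_Re_holomorphic[OF h])
qed

text \<open>On the circle, \<open>\<bar>a + z p z\<bar>\<^sup>2 = \<bar>a\<bar>\<^sup>2 + 2 Re (cnj a * z * p z) + \<bar>p z\<bar>\<^sup>2\<close>;
  inside the disk the right hand side exceeds the left one by \<open>(1 - \<bar>z\<bar>\<^sup>2) \<bar>p z\<bar>\<^sup>2\<close>.\<close>

lemma partial_sum_harmonic_majorant:
  "\<exists>q. q holomorphic_on UNIV \<and>
    (\<forall>z\<in>cball 0 1. (cmod (\<Sum>i<n. a i * z ^ i))\<^sup>2 \<le> Re (q z)) \<and>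
    (\<forall>z\<in>sphere 0 1. Re (q z) = (cmod (\<Sum>i<n. a i * z ^ i))\<^sup>2)"
proof (induction n arbitrary: a)
  case 0
  show ?case by (rule exI[of _ "\<lambda>_. 0"]) auto
next
  case (Suc n)
  define p where "p z = (\<Sum>i<n. a (Suc i) * z ^ i)" for z
  from Suc.IH[of "\<lambda>i. a (Suc i)"] obtain q where q: "q holomorphic_on UNIV"
    "\<And>z. z \<in> cball 0 1 \<Longrightarrow> (cmod (p z))\<^sup>2 \<le> Re (q z)" "\<And>z. z \<in> sphere 0 1 \<Longrightarrow> Re (q z) = (cmod (p z))\<^sup>2"
    unfolding p_def by blast
  define Q where "Q z = of_real ((cmod (a 0))\<^sup>2) + 2 * (cnj (a 0) * (z * p z)) + q z" for z
  have sum_Suc: "(\<Sum>i<Suc n. a i * z ^ i) = a 0 + z * p z" for z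
    unfolding p_def by (rule sum_power_Suc_shift)
  have excess: "Re (Q z) - (cmod (a 0 + z * p z))\<^sup>2 = Re (q z) - (cmod z)\<^sup>2 * (cmod (p z))\<^sup>2" for z
    unfolding cmod_add_square by (simp add: Q_def norm_mult power_mult_distrib)
  show ?case
  proof (intro exI[of _ Q] conjI ballI)
    show "Q holomorphic_on UNIV"
      unfolding Q_def p_def by (intro holomorphic_intros q)
  next
    fix z :: complex assume z: "z \<in> cball 0 1"
    have "(cmod z)\<^sup>2 * (cmod (p z))\<^sup>2 \<le> (cmod (p z))\<^sup>2"
      by (intro mult_left_le_one_le) (use z in \<open>auto simp: power_le_one\<close>)
    then show "(cmod (\<Sum>i<Suc n. a i * z ^ i))\<^sup>2 \<le> Re (Q z)"
      unfolding sum_Suc using excess[of z] q(2)[OF z] by linarith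
  next
    fix z :: complex assume "z \<in> sphere 0 1"
    then show "Re (Q z) = (cmod (\<Sum>i<Suc n. a i * z ^ i))\<^sup>2"
      unfolding sum_Suc using excess[of z] q(3)[of z] by simp
  qed
qed

lemma holomorphic_harmonic_majorant:
  assumes F: "F holomorphic_on ball 0 R" "1 < R" and "0 < e"
  obtains q where "q holomorphic_on UNIV" "\<And>z. z \<in> cball 0 1 \<Longrightarrow> (cmod (F z))\<^sup>2 \<le> Re (q z)"
    "\<And>z. z \<in> sphere 0 1 \<Longrightarrow> Re (q z) \<le> (cmod (F z))\<^sup>2 + e"
proof -
  define S where "S n z = (\<Sum>i<n. taylor_coeff F i * z ^ i)" for n z
  have "uniform_limit (cball 0 1) S F sequentially"
    unfolding S_def using F(2) by (intro uniform_limit_power_series[where R = R] taylor_sums[OF F(1)]) auto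
  moreover have "bounded (F ` cball 0 1)"
    by (intro compact_imp_bounded compact_continuous_image holomorphic_on_subset_cball(2)[OF F]) auto
  ultimately have "uniform_limit (cball 0 1) (\<lambda>n z. (cmod (S n z))\<^sup>2) (\<lambda>z. (cmod (F z))\<^sup>2) sequentially"
    by (rule uniform_limit_cmod_square)
  from uniform_limitD[OF this, of "e / 2"] \<open>0 < e\<close>
  obtain n where "\<forall>z\<in>cball 0 1. dist ((cmod (S n z))\<^sup>2) ((cmod (F z))\<^sup>2) < e / 2"
    unfolding eventually_sequentially by (meson half_gt_zero order_refl)
  then have close: "\<bar>(cmod (S n z))\<^sup>2 - (cmod (F z))\<^sup>2\<bar> < e / 2" if "z \<in> cball 0 1" for z
    using that by (simp add: dist_real_def)
  from partial_sum_harmonic_majorant[of "taylor_coeff F" n]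
  obtain q where q: "q holomorphic_on UNIV" "\<And>z. z \<in> cball 0 1 \<Longrightarrow> (cmod (S n z))\<^sup>2 \<le> Re (q z)"
    "\<And>z. z \<in> sphere 0 1 \<Longrightarrow> Re (q z) = (cmod (S n z))\<^sup>2"
    unfolding S_def by blast
  show thesis
  proof (rule that[of "\<lambda>z. q z + of_real (e / 2)"])
    show "(\<lambda>z. q z + of_real (e / 2)) holomorphic_on UNIV" by (intro holomorphic_intros q)
    show "(cmod (F z))\<^sup>2 \<le> Re (q z + of_real (e / 2))" if "z \<in> cball 0 1" for z
      using close[OF that] q(2)[OF that] unfolding abs_less_iff by simp
    show "Re (q z + of_real (e / 2)) \<le> (cmod (F z))\<^sup>2 + e" if "z \<in> sphere 0 1" for z
      using close[of z] q(3)[OF that] that unfolding abs_less_iff by simp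
  qed
qed

lemma harmonic_majorant_at_0:
  assumes F: "continuous_on (sphere 0 1) F" and q: "q holomorphic_on UNIV"
  shows "(\<And>z. z \<in> sphere 0 1 \<Longrightarrow> (cmod (F z))\<^sup>2 \<le> Re (q z)) \<Longrightarrow> h2_mean F 1 \<le> Re (q 0)"
    and "(\<And>z. z \<in> sphere 0 1 \<Longrightarrow> Re (q z) \<le> (cmod (F z))\<^sup>2 + e) \<Longrightarrow> Re (q 0) \<le> h2_mean F 1 + e"
proof -
  have cont: "continuous_on S q" for S
    using holomorphic_on_imp_continuous_on[OF q] continuous_on_subset by blast
  have mean: "Re (q 0) = circle_mean (\<lambda>z. Re (q z))"
    by (intro circle_mean_Re_holomorphic[symmetric] cont holomorphic_on_subset[OF q]) auto
  show "h2_mean F 1 \<le> Re (q 0)" if "\<And>z. z \<in> sphere 0 1 \<Longrightarrow> (cmod (F z))\<^sup>2 \<le> Re (q z)"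
    unfolding mean h2_mean_eq_circle_mean[OF F zero_le_one]
    using that by (intro circle_mean_mono) (auto intro!: continuous_intros F cont)
  assume "\<And>z. z \<in> sphere 0 1 \<Longrightarrow> Re (q z) \<le> (cmod (F z))\<^sup>2 + e"
  then have "Re (q 0) \<le> circle_mean (\<lambda>z. (cmod (F z))\<^sup>2 + e)"
    unfolding mean by (intro circle_mean_mono) (auto intro!: continuous_intros F cont)
  then show "Re (q 0) \<le> h2_mean F 1 + e"
    unfolding h2_mean_eq_circle_mean[OF F zero_le_one]
    by (simp add: circle_mean_add continuous_on_power continuous_on_norm F)
qed

lemma h2_mean_subordinate:
  assumes F: "F holomorphic_on ball 0 R" "1 < R"
    and \<psi>: "continuous_on (cball 0 1) \<psi>" "\<psi> holomorphic_on ball 0 1" "\<psi> ` cball 0 1 \<subseteq> cball 0 1"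
    and \<psi>0: "cmod (\<psi> 0) < 1"
  shows "h2_mean (\<lambda>z. F (\<psi> z)) 1 \<le> harnack_const (\<psi> 0) * h2_mean F 1"
proof -
  define C where "C = harnack_const (\<psi> 0)"
  have C: "0 < C" unfolding C_def by (rule harnack_const_pos[OF \<psi>0])
  note contF = holomorphic_on_subset_cball(2)[OF F]
  have cont\<psi>: "continuous_on (sphere 0 1) (\<lambda>z. F (\<psi> z))"
    by (rule continuous_on_compose2[OF contF[OF order_refl]])
       (use \<psi>(3) in \<open>auto intro: continuous_on_subset[OF \<psi>(1)]\<close>)
  have "h2_mean (\<lambda>z. F (\<psi> z)) 1 \<le> C * h2_mean F 1 + e" if "0 < e" for e
  proof -
    have "0 < e / C" using \<open>0 < e\<close> C by simp
    then obtain q where q: "q holomorphic_on UNIV" "\<And>z. z \<in> cball 0 1 \<Longrightarrow> (cmod (F z))\<^sup>2 \<le> Re (q z)"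
      "\<And>z. z \<in> sphere 0 1 \<Longrightarrow> Re (q z) \<le> (cmod (F z))\<^sup>2 + e / C"
      by (rule holomorphic_harmonic_majorant[OF F]) blast
    have contq: "continuous_on S q" and holq: "q holomorphic_on S" for S
      using holomorphic_on_imp_continuous_on[OF q(1)] continuous_on_subset holomorphic_on_subset[OF q(1)]
      by blast+
    have "h2_mean (\<lambda>z. F (\<psi> z)) 1 = circle_mean (\<lambda>z. (cmod (F (\<psi> z)))\<^sup>2)"
      using h2_mean_eq_circle_mean[OF cont\<psi>] by simp
    also have "\<dots> \<le> circle_mean (\<lambda>z. Re (q (\<psi> z)))"
      by (intro circle_mean_mono continuous_intros cont\<psi> q(2) continuous_on_compose2[OF contq[of UNIV]]
          continuous_on_subset[OF \<psi>(1)]) (use \<psi>(3) in force)+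
    also have "\<dots> = Re (q (\<psi> 0))"
      by (intro circle_mean_Re_holomorphic continuous_on_compose2[OF contq[of UNIV] \<psi>(1)]
          holomorphic_on_compose[OF \<psi>(2) holq, unfolded o_def]) auto
    also have "\<dots> \<le> C * Re (q 0)"
      unfolding C_def using \<psi>0 by (intro harnack_Re(2) contq holq) (auto intro: order_trans[OF _ q(2)])
    also have "\<dots> \<le> C * (h2_mean F 1 + e / C)"
      by (intro mult_left_mono harmonic_majorant_at_0(2) contF q) (use C in auto)
    finally show ?thesis using C by (simp add: distrib_left)
  qed
  then show ?thesis unfolding C_def by (rule field_le_epsilon)
qed

definition radii :: "nat \<Rightarrow> real" where
  "radii n = 1 - inverse (real (Suc n))"

lemma radii_bounds: "0 \<le> radii n" "radii n < 1"
  by (auto simp: radii_def field_simps)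

lemma mono_radii: "mono radii"
  by (intro monoI) (auto simp: radii_def intro!: le_imp_inverse_le)

lemma radii_tendsto: "radii \<longlonglongrightarrow> 1"
  unfolding radii_def[abs_def] using LIMSEQ_inverse_real_of_nat_add_minus[of 1] by simp

lemma filterlim_radii_at_left: "filterlim radii (at_left 1) sequentially"
  unfolding filterlim_at using radii_tendsto radii_bounds
  by (auto intro!: always_eventually simp: less_imp_neq)

lemma uniform_limit_dilate:
  fixes f :: "complex \<Rightarrow> 'a::metric_space"
  assumes "continuous_on (ball 0 1) f" "\<rho> < 1"
  shows "uniform_limit (cball 0 \<rho>) (\<lambda>n z. f (of_real (radii n) * z)) f sequentially"
proof (rule uniform_limit_compose_uniformly_continuous_on[where f = f and B = "cball 0 \<rho>"])
  show "uniformly_continuous_on (cball 0 \<rho>) f"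
    using assms by (intro compact_uniformly_continuous compact_cball continuous_on_subset[OF assms(1)]) auto
  have "uniform_limit (cball 0 \<rho>) (\<lambda>n _. of_real (radii n) :: complex) (\<lambda>_. of_real 1) sequentially"
    using tendstoD[OF tendsto_of_real[OF radii_tendsto]]
    by (auto intro!: uniform_limitI elim: eventually_mono)
  from uniform_lim_mult[OF this uniform_limit_const[where c = "\<lambda>z. z"]]
  show "uniform_limit (cball 0 \<rho>) (\<lambda>n z. of_real (radii n) * z) (\<lambda>z. z :: complex) sequentially"
    by (simp add: image_constant_conv)
  have "radii n * cmod z \<le> \<rho>" if "cmod z \<le> \<rho>" for n and z :: complex
    using that radii_bounds[of n] mult_left_le_one_le[of "cmod z" "radii n"] by auto
  then show "\<forall>\<^sub>F n in sequentially. \<forall>z\<in>cball 0 \<rho>. complex_of_real (radii n) * z \<in> cball 0 \<rho>"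
    by (simp add: norm_mult radii_bounds)
qed simp

lemma h2_mean_subordinate_dilate:
  assumes f: "f \<in> H2" and \<psi>: "\<psi> holomorphic_on ball 0 1" "\<psi> ` ball 0 1 \<subseteq> ball 0 1"
    and s: "0 \<le> s" "s < 1" and r: "0 \<le> r" "r < 1"
  shows "h2_mean (\<lambda>z. f (of_real s * \<psi> z)) r \<le> harnack_const (\<psi> 0) * (h2_norm f)\<^sup>2"
proof -
  obtain S where S: "1 < S" "(\<lambda>z. f (of_real s * z)) holomorphic_on ball 0 S"
    by (rule holomorphic_on_dilate[OF H2_holomorphic[OF f] s])
  obtain T where T: "1 < T" "(\<lambda>z. \<psi> (of_real r * z)) holomorphic_on ball 0 T"
    by (rule holomorphic_on_dilate[OF \<psi>(1) r])
  have \<psi>0: "cmod (\<psi> 0) < 1" using \<psi>(2) by (auto simp: image_subset_iff)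
  have maps: "(\<lambda>z. \<psi> (of_real r * z)) ` cball 0 1 \<subseteq> cball 0 1"
    using dilate_in_ball[OF r] \<psi>(2) ball_subset_cball by blast
  have "h2_mean (\<lambda>z. f (of_real s * \<psi> (of_real r * z))) 1
      \<le> harnack_const (\<psi> (of_real r * 0)) * h2_mean (\<lambda>z. f (of_real s * z)) 1"
    using \<psi>0 by (intro h2_mean_subordinate[OF S(2,1)] holomorphic_on_subset_cball[OF T(2,1)] maps) auto
  also have "h2_mean (\<lambda>z. f (of_real s * \<psi> (of_real r * z))) 1 = h2_mean (\<lambda>z. f (of_real s * \<psi> z)) r"
    using h2_mean_dilate[of "\<lambda>z. f (of_real s * \<psi> z)" r 1] by simp
  also have "harnack_const (\<psi> (of_real r * 0)) * h2_mean (\<lambda>z. f (of_real s * z)) 1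
      \<le> harnack_const (\<psi> 0) * (h2_norm f)\<^sup>2"
    unfolding h2_mean_dilate mult_zero_right mult_1_right using harnack_const_pos[OF \<psi>0]
    by (intro mult_left_mono h2_mean_le_norm f s) auto
  finally show ?thesis .
qed

lemma h2_mean_subordinate_dilate_tendsto:
  fixes f \<psi> :: "complex \<Rightarrow> complex"
  assumes f: "continuous_on (ball 0 1) f" and \<psi>: "continuous_on (ball 0 1) \<psi>" "\<psi> ` ball 0 1 \<subseteq> ball 0 1"
    and r: "0 \<le> r" "r < 1"
  shows "(\<lambda>n. h2_mean (\<lambda>z. f (of_real (radii n) * \<psi> z)) r) \<longlonglongrightarrow> h2_mean (\<lambda>z. f (\<psi> z)) r"
proof (rule h2_mean_tendsto)
  have sphere: "sphere 0 r \<subseteq> ball (0 :: complex) 1" using r by auto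
  have "\<exists>x\<in>sphere 0 r. \<forall>z\<in>sphere 0 r. cmod (\<psi> z) \<le> cmod (\<psi> x)"
    using r by (intro continuous_attains_sup continuous_intros continuous_on_subset[OF \<psi>(1) sphere])
      (auto intro: exI[of _ "of_real r"])
  then obtain x where x: "x \<in> sphere 0 r" "\<And>z. z \<in> sphere 0 r \<Longrightarrow> cmod (\<psi> z) \<le> cmod (\<psi> x)" by blast
  have "cmod (\<psi> x) < 1" using x(1) sphere \<psi>(2) by (auto simp: image_subset_iff)
  from uniform_limit_dilate[OF f this]
  show "uniform_limit (sphere 0 r) (\<lambda>n z. f (of_real (radii n) * \<psi> z)) (\<lambda>z. f (\<psi> z)) sequentially"
    by (rule uniform_limit_compose') (use x(2) in auto)
  fix n
  show "continuous_on (sphere 0 r) (\<lambda>z. f (of_real (radii n) * \<psi> z))"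
  proof (rule continuous_on_compose2[OF f])
    show "continuous_on (sphere 0 r) (\<lambda>z. of_real (radii n) * \<psi> z)"
      by (intro continuous_intros continuous_on_subset[OF \<psi>(1) sphere])
    have "radii n * cmod (\<psi> z) < 1" if "z \<in> sphere 0 r" for z
      using that sphere \<psi>(2) radii_bounds[of n] mult_left_le_one_le[of "cmod (\<psi> z)" "radii n"]
      by (fastforce simp: image_subset_iff)
    then show "(\<lambda>z. of_real (radii n) * \<psi> z) ` sphere 0 r \<subseteq> ball 0 1"
      by (auto simp: norm_mult radii_bounds)
  qed
qed (use r in auto)

theorem littlewood_subordination:
  assumes f: "f \<in> H2" and \<psi>: "\<psi> holomorphic_on ball 0 1" "\<psi> ` ball 0 1 \<subseteq> ball 0 1"
  shows "(\<lambda>z. f (\<psi> z)) \<in> H2"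
    and "(h2_norm (\<lambda>z. f (\<psi> z)))\<^sup>2 \<le> harnack_const (\<psi> 0) * (h2_norm f)\<^sup>2"
proof -
  define C where "C = harnack_const (\<psi> 0)"
  have mean: "h2_mean (\<lambda>z. f (\<psi> z)) r \<le> C * (h2_norm f)\<^sup>2" if r: "0 \<le> r" "r < 1" for r
  proof (rule LIMSEQ_le_const2)
    show "(\<lambda>n. h2_mean (\<lambda>z. f (of_real (radii n) * \<psi> z)) r) \<longlonglongrightarrow> h2_mean (\<lambda>z. f (\<psi> z)) r"
      by (intro h2_mean_subordinate_dilate_tendsto holomorphic_on_imp_continuous_on H2_holomorphic f \<psi> r)
    show "\<exists>N. \<forall>n\<ge>N. h2_mean (\<lambda>z. f (of_real (radii n) * \<psi> z)) r \<le> C * (h2_norm f)\<^sup>2"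
      unfolding C_def using h2_mean_subordinate_dilate[OF f \<psi> radii_bounds r] by blast
  qed
  have hol: "(\<lambda>z. f (\<psi> z)) holomorphic_on ball 0 1"
    using holomorphic_on_compose_gen[OF \<psi>(1) H2_holomorphic[OF f] \<psi>(2)] by (simp add: o_def)
  show "(\<lambda>z. f (\<psi> z)) \<in> H2" by (rule H2I[OF hol mean])
  then show "(h2_norm (\<lambda>z. f (\<psi> z)))\<^sup>2 \<le> harnack_const (\<psi> 0) * (h2_norm f)\<^sup>2"
    unfolding C_def[symmetric] by (rule h2_norm_square_le) (rule mean)
qed

lemma H2_point_evaluation:
  assumes "f \<in> H2" "cmod z < 1"
  shows "(cmod (f z))\<^sup>2 \<le> harnack_const z * (h2_norm f)\<^sup>2"
proof -
  have "(\<lambda>_. z) ` ball 0 1 \<subseteq> ball 0 1" using assms(2) by auto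
  from littlewood_subordination(2)[OF assms(1) holomorphic_on_const this]
  show ?thesis by (simp add: h2_norm_const)
qed

section \<open>The maximal inequality\<close>

lemma integral_periodic:
  fixes g :: "real \<Rightarrow> 'a::banach"
  assumes int: "\<And>a b. g integrable_on {a..b}" and per: "\<And>x. g (x + p) = g x" and "0 < p"
  shows "integral {a..a + p} g = integral {0..p} g"
proof -
  interpret periodic_fun_simple g p by unfold_locales (rule per)
  define b where "b = a - of_int \<lfloor>a / p\<rfloor> * p"
  have b: "0 \<le> b" "b \<le> p"
    using floor_divide_lower[OF \<open>0 < p\<close>, of a] floor_divide_upper[OF \<open>0 < p\<close>, of a]
    by (auto simp: b_def algebra_simps)
  have shift: "integral {c - of_int n * p..d - of_int n * p} g = integral {c..d} g" for c d n
    using integral_shift_real_ivl[of c "of_int n * p" d g] by (simp add: plus_of_int)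
  have "integral {a..a + p} g = integral {b..b + p} g"
    using shift[of a "\<lfloor>a / p\<rfloor>" "a + p"] by (simp add: b_def algebra_simps)
  also have "\<dots> = integral {b..p} g + integral {p..b + p} g"
    using b by (intro Henstock_Kurzweil_Integration.integral_combine[symmetric] int) auto
  also have "integral {p..b + p} g = integral {0..b} g"
    using shift[of p 1 "b + p"] by simp
  also have "integral {b..p} g + integral {0..b} g = integral {0..p} g"
    using Henstock_Kurzweil_Integration.integral_combine[OF b int] by (simp add: add.commute)
  finally show ?thesis .
qed

lemma integral_symmetrize:
  fixes h :: "real \<Rightarrow> 'a::banach"
  assumes int: "\<And>a b. h integrable_on {a..b}" and "0 \<le> c"
  shows "integral {t - c..t + c} h = integral {0..c} (\<lambda>x. h (t + x) + h (t - x))"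
proof -
  have right: "((\<lambda>x. h (t + x)) has_integral integral {t..t + c} h) {0..c}"
    using has_integral_shift_real_ivl[OF integrable_integral[OF int[of t "t + c"]], of t]
    by (simp add: add.commute)
  have "((\<lambda>x. h (t + x)) has_integral integral {t - c..t} h) {- c..- 0}"
    using has_integral_shift_real_ivl[OF integrable_integral[OF int[of "t - c" t]], of t]
    by (simp add: add.commute)
  then have left: "((\<lambda>x. h (t - x)) has_integral integral {t - c..t} h) {0..c}"
    using has_integral_reflect_real[where f = "\<lambda>x. h (t - x)" and a = 0 and b = c]
    by (simp only: diff_minus_eq_add)
  have "integral {t - c..t + c} h = integral {t - c..t} h + integral {t..t + c} h"
    using \<open>0 \<le> c\<close> by (intro Henstock_Kurzweil_Integration.integral_combine[symmetric] int) auto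
  then show ?thesis
    using integral_unique[OF has_integral_add[OF right left]] by (simp add: add.commute)
qed

lemma poisson_kernel_rotate:
  "poisson_kernel (of_real r * cis t) (cis (t + x)) = poisson_kernel (of_real r) (cis x)"
proof -
  have "cis (t + x) - of_real r * cis t = cis t * (cis x - of_real r)"
    by (simp add: algebra_simps cis_mult)
  then show ?thesis by (simp add: poisson_kernel_def norm_mult)
qed

lemma poisson_kernel_real_eq:
  "poisson_kernel (of_real r) (cis x) = (1 - r\<^sup>2) / (1 - 2 * r * cos x + r\<^sup>2)"
proof -
  have "(cmod (cis x - of_real r))\<^sup>2 = (cos x - r)\<^sup>2 + (sin x)\<^sup>2"
    by (simp add: cmod_power2)
  also have "\<dots> = 1 - 2 * r * cos x + r\<^sup>2"
    using sin_cos_squared_add2[of x] by (simp add: power2_eq_square algebra_simps)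
  finally show ?thesis by (simp add: poisson_kernel_def)
qed

lemma poisson_kernel_antimono:
  assumes r: "0 \<le> r" "r < 1" and "0 \<le> x" "x \<le> y" "y \<le> pi"
  shows "poisson_kernel (of_real r) (cis y) \<le> poisson_kernel (of_real r) (cis x)"
  unfolding poisson_kernel_real_eq
proof (intro divide_left_mono mult_pos_pos)
  have "r * cos y \<le> r * cos x" using assms by (intro mult_left_mono cos_monotone_0_pi_le) auto
  then show "1 - 2 * r * cos x + r\<^sup>2 \<le> 1 - 2 * r * cos y + r\<^sup>2" by simp
  have pos: "0 < 1 - 2 * r * cos u + r\<^sup>2" for u
  proof -
    have "0 < (1 - r)\<^sup>2" using r by simp
    also have "(1 - r)\<^sup>2 \<le> 1 - 2 * r * cos u + r\<^sup>2"
      using r mult_left_mono[of "cos u" 1 r] by (simp add: power2_eq_square algebra_simps)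
    finally show ?thesis .
  qed
  show "0 < 1 - 2 * r * cos x + r\<^sup>2" "0 < 1 - 2 * r * cos y + r\<^sup>2" by (rule pos)+
  show "0 \<le> 1 - r\<^sup>2" using r by (simp add: power_le_one)
qed

lemma poisson_integral_cis:
  assumes r: "0 \<le> r" "r < 1" and g: "continuous_on (sphere 0 1) g"
  shows "2 * pi * poisson_integral g (of_real r * cis t)
    = integral {0..pi} (\<lambda>x. poisson_kernel (of_real r) (cis x) * (g (cis (t + x)) + g (cis (t - x))))"
proof -
  define h where "h x = poisson_kernel (of_real r * cis t) (cis x) * g (cis x)" for x
  have "cmod (of_real r * cis t) < 1" using r by (simp add: norm_mult)
  then have int: "h integrable_on {a..b}" for a b
    unfolding h_def by (intro integrable_circle_cis continuous_intros continuous_on_poisson_kernel g)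
  have per: "h (x + 2 * pi) = h x" for x
    unfolding h_def by (simp add: cis_mult[symmetric])
  have "2 * pi * poisson_integral g (of_real r * cis t) = integral {0..2*pi} h"
    by (simp add: poisson_integral_def circle_mean_def h_def[abs_def])
  also have "\<dots> = integral {t - pi..t + pi} h"
    using integral_periodic[OF int per, of "t - pi"] by (simp add: add.commute)
  also have "\<dots> = integral {0..pi} (\<lambda>x. h (t + x) + h (t - x))"
    by (rule integral_symmetrize[OF int]) simp
  also have "\<dots> = integral {0..pi}
      (\<lambda>x. poisson_kernel (of_real r) (cis x) * (g (cis (t + x)) + g (cis (t - x))))"
  proof -
    have "poisson_kernel (of_real r * cis t) (cis (t - x)) = poisson_kernel (of_real r) (cis x)" for x
      using poisson_kernel_rotate[of r t "- x"] by (simp add: poisson_kernel_real_eq)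
    then show ?thesis by (simp add: h_def poisson_kernel_rotate distrib_left)
  qed
  finally show ?thesis .
qed

lemma integral_antimono_mult_nonneg:
  fixes k d :: "real \<Rightarrow> real"
  assumes "a \<le> b" and d: "d integrable_on {a..b}"
    and k: "\<And>x y. a \<le> x \<Longrightarrow> x \<le> y \<Longrightarrow> y \<le> b \<Longrightarrow> k y \<le> k x" "0 \<le> k b"
    and primitive: "\<And>c. a \<le> c \<Longrightarrow> c \<le> b \<Longrightarrow> 0 \<le> integral {a..c} d"
  shows "0 \<le> integral {a..b} (\<lambda>x. k x * d x)"
proof -
  obtain c where "c \<in> {a..b}" and
    mean_value: "integral {a..b} (\<lambda>x. - k x * d x) = - k a * integral {a..c} d + - k b * integral {c..b} d"
    by (rule second_mean_value_theorem[OF d \<open>a \<le> b\<close>, of "\<lambda>x. - k x"]) (auto intro: k(1))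
  then have c: "a \<le> c" "c \<le> b" by auto
  have "0 \<le> (k a - k b) * integral {a..c} d + k b * integral {a..b} d"
    using c k \<open>a \<le> b\<close> by (intro add_nonneg_nonneg mult_nonneg_nonneg primitive) auto
  also have "integral {a..b} d = integral {a..c} d + integral {c..b} d"
    by (rule Henstock_Kurzweil_Integration.integral_combine[OF c d, symmetric])
  also have "(k a - k b) * integral {a..c} d + k b * (integral {a..c} d + integral {c..b} d)
      = integral {a..b} (\<lambda>x. k x * d x)"
    using mean_value by (simp add: algebra_simps)
  finally show ?thesis .
qed

lemma poisson_integral_le_of_means_le:
  assumes r: "0 \<le> r" "r < 1" and g: "continuous_on (sphere 0 1) g"
    and means: "\<And>x. 0 < x \<Longrightarrow> x \<le> pi \<Longrightarrow> integral {t - x..t + x} (\<lambda>u. g (cis u)) \<le> M * (2 * x)"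
  shows "poisson_integral g (of_real r * cis t) \<le> M"
proof -
  define k where "k x = poisson_kernel (of_real r) (cis x)" for x
  define h where "h x = g (cis (t + x)) + g (cis (t - x))" for x
  have cont_h: "continuous_on S h" for S
    unfolding h_def
    by (intro continuous_intros continuous_on_compose2[OF continuous_on_circle_cis[OF g, of UNIV]]) auto
  have cont_k: "continuous_on S k" for S
    unfolding k_def using r by (intro continuous_on_circle_cis continuous_on_poisson_kernel) simp
  have "0 \<le> integral {0..pi} (\<lambda>x. k x * (2 * M - h x))"
  proof (rule integral_antimono_mult_nonneg)
    show "0 \<le> integral {0..c} (\<lambda>x. 2 * M - h x)" if c: "0 \<le> c" "c \<le> pi" for c
    proof -
      have "integral {0..c} (\<lambda>x. 2 * M - h x) = 2 * M * c - integral {t - c..t + c} (\<lambda>u. g (cis u))"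
        using c by (subst integral_diff)
          (auto simp: integral_symmetrize[OF integrable_circle_cis[OF g] c(1)] h_def[symmetric]
            intro: integrable_continuous_real cont_h)
      then show ?thesis using means[of c] c by (cases "c = 0") (auto simp: mult_ac)
    qed
    show "0 \<le> k pi" using r by (simp add: k_def poisson_kernel_nonneg)
  qed (auto simp: k_def poisson_kernel_antimono[OF r]
      intro!: integrable_continuous_real continuous_intros cont_h)
  also have "\<dots> = M * integral {0..pi} (\<lambda>x. k x * (1 + 1)) - integral {0..pi} (\<lambda>x. k x * h x)"
    unfolding integral_mult_right[symmetric]
    by (subst integral_diff[symmetric])
       (auto intro!: integrable_continuous_real continuous_intros cont_h cont_k
          simp: right_diff_distrib mult_ac)
  also have "\<dots> = 2 * pi * (M - poisson_integral g (of_real r * cis t))"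
    using poisson_integral_cis[OF r g, of t] poisson_integral_cis[OF r, of "\<lambda>_. 1" t] r
    by (simp add: k_def h_def poisson_integral_const norm_mult algebra_simps)
  finally show ?thesis using pi_gt_zero by (auto simp: zero_le_mult_iff)
qed

lemma sum_integral_disjoint_le:
  fixes g :: "'a::euclidean_space \<Rightarrow> real"
  assumes "finite I" "pairwise (\<lambda>i j. disjnt (B i) (B j)) I" "(\<Union>i\<in>I. B i) \<subseteq> S"
    and "\<And>i. i \<in> I \<Longrightarrow> g integrable_on B i" "g integrable_on S" "\<And>x. x \<in> S \<Longrightarrow> 0 \<le> g x"
  shows "(\<Sum>i\<in>I. integral (B i) g) \<le> integral S g"
proof -
  have "pairwise (\<lambda>i j. negligible (B i \<inter> B j)) I"
    by (rule pairwise_mono[OF assms(2)]) (auto simp: disjnt_def)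
  then have "(g has_integral (\<Sum>i\<in>I. integral (B i) g)) (\<Union>i\<in>I. B i)"
    using assms by (intro has_integral_UN integrable_integral) auto
  then show ?thesis
    using integrable_integral[OF assms(5)] assms(3,6) by (intro has_integral_subset_le) auto
qed

lemma measure_UN_dilated_intervals_le:
  fixes g :: "real \<Rightarrow> real"
  assumes int: "\<And>c d. g integrable_on {c..d}" and nonneg: "\<And>x. 0 \<le> g x" and "0 < \<kappa>"
    and I: "finite I" "pairwise (\<lambda>i j. disjnt (cball i (x i)) (cball j (x j))) I"
      "(\<Union>i\<in>I. cball i (x i)) \<subseteq> {a..b}"
    and x: "\<And>i. i \<in> I \<Longrightarrow> 0 < x i" "\<And>i. i \<in> I \<Longrightarrow> \<kappa> * (2 * x i) < integral {i - x i..i + x i} g"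
  shows "measure lborel (\<Union>i\<in>I. cball i (5 * x i)) \<le> 5 / \<kappa> * integral {a..b} g"
proof -
  have "measure lborel (\<Union>i\<in>I. cball i (5 * x i)) \<le> (\<Sum>i\<in>I. measure lborel (cball i (5 * x i)))"
    by (rule measure_UNION_le[OF I(1)]) auto
  also have "\<dots> = (\<Sum>i\<in>I. 5 / \<kappa> * (\<kappa> * (2 * x i)))"
    using x(1) \<open>0 < \<kappa>\<close> by (intro sum.cong) (auto simp: cball_eq_atLeastAtMost less_imp_le)
  also have "\<dots> \<le> (\<Sum>i\<in>I. 5 / \<kappa> * integral (cball i (x i)) g)"
    using x(2) \<open>0 < \<kappa>\<close>
    by (intro sum_mono mult_left_mono) (auto simp: cball_eq_atLeastAtMost less_imp_le)
  also have "\<dots> = 5 / \<kappa> * (\<Sum>i\<in>I. integral (cball i (x i)) g)" by (simp add: sum_distrib_left)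
  also have "\<dots> \<le> 5 / \<kappa> * integral {a..b} g"
    using \<open>0 < \<kappa>\<close>
    by (intro mult_left_mono sum_integral_disjoint_le[OF I]) (auto simp: cball_eq_atLeastAtMost int nonneg)
  finally show ?thesis .
qed

theorem hardy_littlewood_weak_type:
  fixes g :: "real \<Rightarrow> real"
  assumes int: "\<And>c d. g integrable_on {c..d}" and nonneg: "\<And>x. 0 \<le> g x" and "0 < \<kappa>"
    and E: "E \<in> sets lborel" "E \<subseteq> {a..b}"
    and large: "\<And>t. t \<in> E \<Longrightarrow> \<exists>x. 0 < x \<and> x \<le> \<delta> \<and> \<kappa> * (2 * x) < integral {t - x..t + x} g"
  shows "measure lborel E \<le> 5 / \<kappa> * integral {a - \<delta>..b + \<delta>} g"
proof -
  obtain x where x: "\<And>t. t \<in> E \<Longrightarrow> 0 < x t \<and> x t \<le> \<delta>"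
    "\<And>t. t \<in> E \<Longrightarrow> \<kappa> * (2 * x t) < integral {t - x t..t + x t} g"
    using large by metis
  have "E \<subseteq> (\<Union>t\<in>E. cball t (x t))" using x(1) by (force intro: less_imp_le)
  then obtain C where C: "countable C" "C \<subseteq> E"
    "pairwise (\<lambda>i j. disjnt (cball i (x i)) (cball j (x j))) C" "E \<subseteq> (\<Union>i\<in>C. cball i (5 * x i))"
    by (rule Vitali_covering_lemma_cballs) (rule x)
  have bound: "measure lborel (\<Union>i\<in>I. cball i (5 * x i)) \<le> 5 / \<kappa> * integral {a - \<delta>..b + \<delta>} g"
    if I: "I \<subseteq> C" "finite I" for I
  proof (rule measure_UN_dilated_intervals_le[OF int nonneg \<open>0 < \<kappa>\<close> I(2) pairwise_subset[OF C(3) I(1)]])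
    have IE: "I \<subseteq> E" using I(1) C(2) by blast
    show "(\<Union>i\<in>I. cball i (x i)) \<subseteq> {a - \<delta>..b + \<delta>}"
      using x(1) IE E(2) by (fastforce simp: cball_eq_atLeastAtMost)
    show "0 < x i" "\<kappa> * (2 * x i) < integral {i - x i..i + x i} g" if "i \<in> I" for i
      using x that IE by blast+
  qed
  have balls: "cball i (5 * x i) \<in> fmeasurable lborel" for i
    by (intro fmeasurable_compact) simp
  have "measure lborel E \<le> measure lborel (\<Union>i\<in>C. cball i (5 * x i))"
    using E(1) by (intro measure_mono_fmeasurable[OF C(4)] fmeasurable_UN_bound[OF C(1) balls bound])
  also have "\<dots> \<le> 5 / \<kappa> * integral {a - \<delta>..b + \<delta>} g"
    by (rule measure_UN_bound[OF C(1) balls bound])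
  finally show ?thesis .
qed

lemma poisson_maximal_weak_type:
  assumes g: "continuous_on (sphere 0 1) g" "\<And>\<zeta>. cmod \<zeta> = 1 \<Longrightarrow> 0 \<le> g \<zeta>" and "0 < \<kappa>"
    and E: "E \<in> sets lborel" "E \<subseteq> {0..2*pi}"
    and large: "\<And>t. t \<in> E \<Longrightarrow> \<exists>r\<in>{0..<1}. \<kappa> < poisson_integral g (of_real r * cis t)"
  shows "measure lborel E \<le> 20 * pi / \<kappa> * circle_mean g"
proof -
  define h where "h x = g (cis x)" for x
  have int: "h integrable_on {a..b}" for a b
    unfolding h_def by (rule integrable_circle_cis[OF g(1)])
  have per: "h (x + 2 * pi) = h x" for x
    unfolding h_def by (simp add: cis_mult[symmetric])
  have "measure lborel E \<le> 5 / \<kappa> * integral {0 - pi..2 * pi + pi} h"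
  proof (rule hardy_littlewood_weak_type[OF int _ \<open>0 < \<kappa>\<close> E])
    fix t assume "t \<in> E"
    then obtain r where r: "0 \<le> r" "r < 1" "\<kappa> < poisson_integral g (of_real r * cis t)"
      using large by force
    show "\<exists>x. 0 < x \<and> x \<le> pi \<and> \<kappa> * (2 * x) < integral {t - x..t + x} h"
      using poisson_integral_le_of_means_le[OF r(1,2) g(1), of t \<kappa>] r(3)
      unfolding h_def by (meson not_le)
  qed (simp add: h_def g(2))
  also have "integral {0 - pi..2 * pi + pi} h
      = integral {- pi..- pi + 2 * pi} h + integral {pi..pi + 2 * pi} h"
    using Henstock_Kurzweil_Integration.integral_combine[OF _ _ int, of "- pi" pi "3 * pi"] by simp
  also have "\<dots> = 2 * (2 * pi * circle_mean g)"
    unfolding integral_periodic[OF int per mult_pos_pos[OF zero_less_numeral pi_gt_zero]]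
    by (simp add: circle_mean_def h_def[abs_def])
  finally show ?thesis by simp
qed

section \<open>Radial limits\<close>

lemma open_radial_superlevel:
  fixes U :: "complex \<Rightarrow> real"
  assumes "continuous_on (ball 0 1) U" "R \<subseteq> {0..<1}"
  shows "open {t \<in> {a<..<b}. \<exists>r\<in>R. \<kappa> < U (of_real r * cis t)}"
proof -
  have "{t \<in> {a<..<b}. \<exists>r\<in>R. \<kappa> < U (of_real r * cis t)}
      = {a<..<b} \<inter> (\<Union>r\<in>R. {t. \<kappa> < U (of_real r * cis t)})" by auto
  also have "open \<dots>"
  proof (intro open_Int open_greaterThanLessThan open_UN ballI open_Collect_less continuous_intros)
    fix r assume "r \<in> R"
    then show "continuous_on UNIV (\<lambda>t. U (of_real r * cis t))"
      using assms(2)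
      by (intro continuous_on_compose2[OF assms(1)]) (auto intro!: continuous_intros simp: norm_mult)
  qed
  finally show ?thesis .
qed

definition radial_superlevel :: "(complex \<Rightarrow> complex) \<Rightarrow> real \<Rightarrow> real \<Rightarrow> real set" where
  "radial_superlevel f s \<kappa> = {t \<in> {0<..<2*pi}. \<exists>r\<in>{0..<s}. \<kappa> < (cmod (f (of_real r * cis t)))\<^sup>2}"

lemma fmeasurable_radial_superlevel:
  assumes "f holomorphic_on ball 0 1" "s \<le> 1"
  shows "radial_superlevel f s \<kappa> \<in> fmeasurable lborel"
proof (rule fmeasurableI2)
  show "{0<..<2*pi} \<in> fmeasurable lborel" by (auto intro!: fmeasurableI)
  have "open (radial_superlevel f s \<kappa>)"
    unfolding radial_superlevel_def using assms
    by (intro open_radial_superlevel continuous_intros holomorphic_on_imp_continuous_on) auto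
  then show "radial_superlevel f s \<kappa> \<in> sets lborel" by simp
qed (auto simp: radial_superlevel_def)

lemma radial_maximal_weak_type_truncated:
  assumes f: "f \<in> H2" and "0 < \<kappa>" and s: "0 \<le> s" "s < 1"
  shows "measure lborel (radial_superlevel f s \<kappa>) \<le> 20 * pi / \<kappa> * (h2_norm f)\<^sup>2"
proof -
  define F where "F z = f (of_real s * z)" for z
  obtain T where T: "1 < T" "F holomorphic_on ball 0 T"
    using holomorphic_on_dilate[OF H2_holomorphic[OF f] s] unfolding F_def .
  note hol = holomorphic_on_subset_cball(1)[OF T(2,1)] and cont = holomorphic_on_subset_cball(2)[OF T(2,1)]
  have "measure lborel (radial_superlevel f s \<kappa>) \<le> 20 * pi / \<kappa> * circle_mean (\<lambda>\<zeta>. (cmod (F \<zeta>))\<^sup>2)"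
  proof (rule poisson_maximal_weak_type)
    show "radial_superlevel f s \<kappa> \<in> sets lborel"
      using s by (intro fmeasurableD fmeasurable_radial_superlevel H2_holomorphic f) simp
    fix t assume "t \<in> radial_superlevel f s \<kappa>"
    then obtain r where r: "0 \<le> r" "r < s" "\<kappa> < (cmod (f (of_real r * cis t)))\<^sup>2"
      by (auto simp: radial_superlevel_def)
    have "of_real s * (of_real (r / s) * cis t) = of_real r * cis t" using r by simp
    then have "\<kappa> < (cmod (F (of_real (r / s) * cis t)))\<^sup>2" using r(3) by (simp only: F_def)
    also have "\<dots> \<le> poisson_integral (\<lambda>\<zeta>. (cmod (F \<zeta>))\<^sup>2) (of_real (r / s) * cis t)"
      using r by (intro cmod_square_le_poisson_integral cont hol) (auto simp: norm_mult norm_divide)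
    finally show "\<exists>r\<in>{0..<1}. \<kappa> < poisson_integral (\<lambda>\<zeta>. (cmod (F \<zeta>))\<^sup>2) (of_real r * cis t)"
      using r by (intro bexI[of _ "r / s"]) auto
  qed (use \<open>0 < \<kappa>\<close> in \<open>auto simp: radial_superlevel_def intro!: continuous_intros cont\<close>)
  also have "circle_mean (\<lambda>\<zeta>. (cmod (F \<zeta>))\<^sup>2) = h2_mean F 1"
    using h2_mean_eq_circle_mean[of 1 F] cont by simp
  also have "\<dots> = h2_mean f s" by (simp add: F_def[abs_def] h2_mean_dilate)
  also have "20 * pi / \<kappa> * h2_mean f s \<le> 20 * pi / \<kappa> * (h2_norm f)\<^sup>2"
    using \<open>0 < \<kappa>\<close> s by (intro mult_left_mono h2_mean_le_norm f) auto
  finally show ?thesis .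
qed

lemma radial_superlevel_mono: "s \<le> s' \<Longrightarrow> radial_superlevel f s \<kappa> \<subseteq> radial_superlevel f s' \<kappa>"
  by (auto simp: radial_superlevel_def intro: less_le_trans)

lemma radial_superlevel_eq_UN_radii: "radial_superlevel f 1 \<kappa> = (\<Union>n. radial_superlevel f (radii n) \<kappa>)"
proof
  show "radial_superlevel f 1 \<kappa> \<subseteq> (\<Union>n. radial_superlevel f (radii n) \<kappa>)"
  proof
    fix t assume "t \<in> radial_superlevel f 1 \<kappa>"
    then obtain r where r: "t \<in> {0<..<2*pi}" "r \<in> {0..<1}" "\<kappa> < (cmod (f (of_real r * cis t)))\<^sup>2"
      unfolding radial_superlevel_def by blast
    have "eventually (\<lambda>n. r < radii n) sequentially"
      using r(2) by (intro order_tendstoD(1)[OF radii_tendsto]) simp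
    then obtain n where "r < radii n" by (auto simp: eventually_sequentially)
    then have "t \<in> radial_superlevel f (radii n) \<kappa>" using r by (auto simp: radial_superlevel_def)
    then show "t \<in> (\<Union>n. radial_superlevel f (radii n) \<kappa>)" by blast
  qed
qed (intro UN_least radial_superlevel_mono less_imp_le radii_bounds)

theorem radial_maximal_weak_type:
  assumes f: "f \<in> H2" and "0 < \<kappa>"
  shows "measure lborel (radial_superlevel f 1 \<kappa>) \<le> 20 * pi / \<kappa> * (h2_norm f)\<^sup>2"
  unfolding radial_superlevel_eq_UN_radii
proof (rule measure_countable_Union_le)
  show "radial_superlevel f (radii n) \<kappa> \<in> fmeasurable lborel" for n
    by (intro fmeasurable_radial_superlevel H2_holomorphic f less_imp_le radii_bounds)
  have "(\<Union>i\<le>n. radial_superlevel f (radii i) \<kappa>) = radial_superlevel f (radii n) \<kappa>" for n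
    using monoD[OF mono_radii] by (intro equalityI UN_least radial_superlevel_mono) auto
  then show "measure lborel (\<Union>i\<le>n. radial_superlevel f (radii i) \<kappa>) \<le> 20 * pi / \<kappa> * (h2_norm f)\<^sup>2" for n
    using radial_maximal_weak_type_truncated[OF f \<open>0 < \<kappa>\<close> radii_bounds] by simp
qed

lemma null_sets_INT_radial_superlevel:
  assumes F: "\<And>j. F j \<in> H2" "(\<lambda>j::nat. h2_norm (F j)) \<longlonglongrightarrow> 0" and "0 < \<kappa>"
  shows "(\<Inter>j. radial_superlevel (F j) 1 \<kappa>) \<in> null_sets lborel"
proof -
  define N where "N = (\<Inter>j. radial_superlevel (F j) 1 \<kappa>)"
  have fm: "radial_superlevel (F j) 1 \<kappa> \<in> fmeasurable lborel" for j
    by (intro fmeasurable_radial_superlevel H2_holomorphic F(1)) simp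
  then have sets: "N \<in> sets lborel"
    unfolding N_def by (intro sets.countable_INT' image_subsetI fmeasurableD) auto
  have N: "N \<in> fmeasurable lborel"
    by (rule fmeasurableI2[OF fm[of 0] _ sets]) (auto simp: N_def)
  have "(\<lambda>j. 20 * pi / \<kappa> * (h2_norm (F j))\<^sup>2) \<longlonglongrightarrow> 20 * pi / \<kappa> * 0\<^sup>2"
    by (intro tendsto_intros F(2))
  moreover have "measure lborel N \<le> 20 * pi / \<kappa> * (h2_norm (F j))\<^sup>2" for j
    using measure_mono_fmeasurable[OF _ sets fm[of j]] radial_maximal_weak_type[OF F(1) \<open>0 < \<kappa>\<close>, of j]
    unfolding N_def by (meson INT_lower UNIV_I order_trans)
  ultimately have "measure lborel N \<le> 0"
    by (intro LIMSEQ_le_const) auto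
  then have "measure lborel N = 0" by (simp add: measure_le_0_iff)
  then show ?thesis
    using sets emeasure_eq_measure2[OF N] by (simp add: N_def[symmetric] null_sets_def)
qed

lemma AE_radially_small:
  assumes F: "\<And>j. F j \<in> H2" "(\<lambda>j::nat. h2_norm (F j)) \<longlonglongrightarrow> 0"
  shows "AE t in lborel. t \<in> {0<..<2*pi} \<longrightarrow> (\<forall>e>0. \<exists>j. \<forall>r\<in>{0..<1}. cmod (F j (of_real r * cis t)) \<le> e)"
proof -
  have "AE t in lborel. t \<notin> (\<Inter>j. radial_superlevel (F j) 1 ((inverse (real (Suc m)))\<^sup>2))" for m
    by (intro AE_not_in null_sets_INT_radial_superlevel F) simp
  then have "AE t in lborel. \<forall>m. t \<notin> (\<Inter>j. radial_superlevel (F j) 1 ((inverse (real (Suc m)))\<^sup>2))"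
    by (simp add: AE_all_countable)
  then show ?thesis
  proof eventually_elim
    case (elim t)
    show ?case
    proof (intro impI allI)
      fix e :: real assume t: "t \<in> {0<..<2*pi}" and "0 < e"
      obtain m where m: "inverse (real (Suc m)) < e" using reals_Archimedean[OF \<open>0 < e\<close>] by blast
      obtain j where "t \<notin> radial_superlevel (F j) 1 ((inverse (real (Suc m)))\<^sup>2)" using elim by blast
      then have square: "(cmod (F j (of_real r * cis t)))\<^sup>2 \<le> (inverse (real (Suc m)))\<^sup>2"
        if "r \<in> {0..<1}" for r
        using that t unfolding radial_superlevel_def mem_Collect_eq not_less[symmetric] by blast
      have "cmod (F j (of_real r * cis t)) \<le> e" if "r \<in> {0..<1}" for r
        using power2_le_imp_le[OF square[OF that]] m by simp
      then show "\<exists>j. \<forall>r\<in>{0..<1}. cmod (F j (of_real r * cis t)) \<le> e" by blast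
    qed
  qed
qed

lemma ex_tendsto_if_approximated:
  fixes f :: "'b \<Rightarrow> 'a::complete_space"
  assumes approx: "\<And>e. 0 < e \<Longrightarrow> \<exists>g l. (g \<longlongrightarrow> l) F \<and> (\<forall>\<^sub>F x in F. dist (f x) (g x) \<le> e)" and "F \<noteq> bot"
  shows "\<exists>l. (f \<longlongrightarrow> l) F"
proof -
  have "cauchy_filter (filtermap f F)"
    unfolding cauchy_filter_metric_filtermap
  proof (intro allI impI)
    fix e :: real assume "0 < e"
    then obtain g l where gl: "(g \<longlongrightarrow> l) F" "\<forall>\<^sub>F x in F. dist (f x) (g x) \<le> e / 4"
      using approx[of "e / 4"] by auto
    define P where "P x \<longleftrightarrow> dist (f x) (g x) \<le> e / 4 \<and> dist (g x) l < e / 4" for x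
    have "eventually P F"
      unfolding P_def using gl \<open>0 < e\<close> by (intro eventually_conj tendstoD) auto
    moreover have "dist (f x) (f y) < e" if "P x" "P y" for x y
      using that \<open>0 < e\<close> unfolding P_def by metric
    ultimately show "\<exists>P. eventually P F \<and> (\<forall>x y. P x \<and> P y \<longrightarrow> dist (f x) (f y) < e)" by blast
  qed
  then show ?thesis
    using cauchy_filter_complete_converges[OF _ complete_UNIV, of "filtermap f F"] \<open>F \<noteq> bot\<close>
    by (simp add: filtermap_bot_iff filterlim_def)
qed

theorem fatou_radial_limits:
  assumes f: "f \<in> H2"
  shows "AE t in lborel. t \<in> {0..2*pi} \<longrightarrow> (\<exists>L. ((\<lambda>r. f (of_real r * cis t)) \<longlongrightarrow> L) (at_left 1))"
proof -
  define D where "D j z = f z - f (of_real (radii j) * z)" for j z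
  have D: "D j \<in> H2" for j
    unfolding D_def by (intro H2_diff H2_dilate f radii_bounds)
  have "(\<lambda>j. h2_norm (D j)) \<longlonglongrightarrow> 0"
    unfolding D_def by (rule filterlim_compose[OF h2_norm_diff_dilate_tendsto[OF f] filterlim_radii_at_left])
  note small = AE_radially_small[OF D this]
  have "AE t in lborel. t \<noteq> 0 \<and> t \<noteq> 2 * pi"
    using AE_lborel_singleton[of 0] AE_lborel_singleton[of "2 * pi"] by (rule AE_conjI)
  with small show ?thesis
  proof eventually_elim
    case (elim t)
    show ?case
    proof (intro impI ex_tendsto_if_approximated)
      fix e :: real assume t: "t \<in> {0..2*pi}" and "0 < e"
      then obtain j where j: "\<And>r. r \<in> {0..<1} \<Longrightarrow> cmod (D j (of_real r * cis t)) \<le> e"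
        using elim by (metis atLeastAtMost_iff greaterThanLessThan_iff less_le)
      define g where "g r = f (of_real (radii j) * (of_real r * cis t))" for r :: real
      have "isCont f (of_real (radii j) * (of_real 1 * cis t))"
        by (intro H2_isCont[OF f] dilate_in_ball radii_bounds) simp
      then have "(g \<longlongrightarrow> f (of_real (radii j) * (of_real 1 * cis t))) (at_left 1)"
        unfolding g_def by (rule isCont_tendsto_compose) (intro tendsto_intros)
      moreover have "\<forall>\<^sub>F r in at_left 1. dist (f (of_real r * cis t)) (g r) \<le> e"
        using eventually_unit_interval_at_left
        by (rule eventually_mono) (use j in \<open>auto simp: D_def g_def dist_norm\<close>)
      ultimately show "\<exists>g l. (g \<longlongrightarrow> l) (at_left 1) \<and>
          (\<forall>\<^sub>F r in at_left 1. dist (f (of_real r * cis t)) (g r) \<le> e)"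
        by blast
    qed simp
  qed
qed

section \<open>Boundary values and powers\<close>

definition boundary_value :: "(complex \<Rightarrow> complex) \<Rightarrow> real \<Rightarrow> complex" where
  "boundary_value f t = lim (\<lambda>n. f (of_real (radii n) * cis t))"

lemma tendsto_radii_boundary_value:
  assumes "((\<lambda>r. f (of_real r * cis t)) \<longlongrightarrow> L) (at_left 1)"
  shows "(\<lambda>n. f (of_real (radii n) * cis t)) \<longlonglongrightarrow> L" "boundary_value f t = L"
proof -
  show "(\<lambda>n. f (of_real (radii n) * cis t)) \<longlonglongrightarrow> L"
    by (rule filterlim_compose[OF assms filterlim_radii_at_left])
  then show "boundary_value f t = L" unfolding boundary_value_def by (rule limI)
qed

lemma AE_tendsto_boundary_value:
  assumes "f \<in> H2"
  shows "AE t in lborel. t \<in> {0..2*pi} \<longrightarrow> ((\<lambda>r. f (of_real r * cis t)) \<longlongrightarrow> boundary_value f t) (at_left 1)"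
  using fatou_radial_limits[OF assms] by eventually_elim (metis tendsto_radii_boundary_value(2))

lemma borel_measurable_circle:
  assumes "f holomorphic_on ball 0 1" "0 \<le> r" "r < 1"
  shows "(\<lambda>t. f (of_real r * cis t)) \<in> borel_measurable borel"
proof (rule borel_measurable_continuous_onI)
  have "continuous_on (sphere 0 1) (\<lambda>z. f (of_real r * z))"
    by (intro continuous_on_sphere_scale holomorphic_on_subset_cball(2)[OF assms(1,3)] sphere_cball assms)
  then show "continuous_on UNIV (\<lambda>t. f (of_real r * cis t))" by (rule continuous_on_circle_cis)
qed

lemma borel_measurable_boundary_value:
  assumes "f holomorphic_on ball 0 1"
  shows "boundary_value f \<in> borel_measurable borel"
  unfolding boundary_value_def[abs_def]
  by (intro borel_measurable_lim_metric borel_measurable_circle assms radii_bounds)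

lemma set_integral_bounded_convergence:
  fixes u :: "nat \<Rightarrow> 'a \<Rightarrow> real"
  assumes [measurable]: "\<And>n. u n \<in> borel_measurable M" "v \<in> borel_measurable M" and A: "A \<in> fmeasurable M"
    and lim: "AE t in M. t \<in> A \<longrightarrow> (\<lambda>n. u n t) \<longlonglongrightarrow> v t"
    and bound: "\<And>n. AE t in M. t \<in> A \<longrightarrow> \<bar>u n t\<bar> \<le> B"
  shows "(\<lambda>n. LINT t:A|M. u n t) \<longlonglongrightarrow> (LINT t:A|M. v t)"
  unfolding set_lebesgue_integral_def
proof (rule integral_dominated_convergence)
  have [measurable]: "A \<in> sets M" using A by (rule fmeasurableD)
  show "integrable M (\<lambda>t. indicator A t * B)"
    using A by (intro integrable_mult_left) (simp add: integrable_indicator_iff fmeasurable_def)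
  show "(\<lambda>t. indicator A t *\<^sub>R v t) \<in> borel_measurable M"
    "(\<lambda>t. indicator A t *\<^sub>R u n t) \<in> borel_measurable M" for n
    by measurable
  show "AE t in M. (\<lambda>n. indicator A t *\<^sub>R u n t) \<longlonglongrightarrow> indicator A t *\<^sub>R v t"
    using lim by eventually_elim (auto split: split_indicator)
  show "AE t in M. norm (indicator A t *\<^sub>R u n t) \<le> indicator A t * B" for n
    using bound[of n] by eventually_elim (auto split: split_indicator)
qed

lemma h2_norm_square_eq_boundary:
  assumes f: "f holomorphic_on ball 0 1" and bound: "f ` ball 0 1 \<subseteq> cball 0 1"
  shows "(h2_norm f)\<^sup>2 = (1 / (2 * pi)) * (LINT t:{0..2*pi}|lborel. (cmod (boundary_value f t))\<^sup>2)"
proof (rule LIMSEQ_unique)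
  note H2 = H2_bounded(1)[OF f bound]
  show "(\<lambda>n. h2_mean f (radii n)) \<longlonglongrightarrow> (h2_norm f)\<^sup>2"
    by (rule filterlim_compose[OF h2_mean_tendsto_norm[OF H2] filterlim_radii_at_left])
  have "of_real (radii n) * cis t \<in> ball 0 1" for n t by (intro dilate_in_ball radii_bounds) simp
  then have "cmod (f (of_real (radii n) * cis t)) \<le> 1" for n t
    using bound by (simp add: image_subset_iff del: mem_ball_0)
  then show "(\<lambda>n. h2_mean f (radii n)) \<longlonglongrightarrow>
      (1 / (2 * pi)) * (LINT t:{0..2*pi}|lborel. (cmod (boundary_value f t))\<^sup>2)"
    unfolding h2_mean_def
  proof (intro tendsto_intros set_integral_bounded_convergence[where B = 1])
    show "(\<lambda>t. (cmod (f (of_real (radii n) * cis t)))\<^sup>2) \<in> borel_measurable lborel" for n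
      using borel_measurable_circle[OF f radii_bounds] by simp
    show "(\<lambda>t. (cmod (boundary_value f t))\<^sup>2) \<in> borel_measurable lborel"
      using borel_measurable_boundary_value[OF f] by simp
    show "AE t in lborel. t \<in> {0..2*pi} \<longrightarrow>
        (\<lambda>n. (cmod (f (of_real (radii n) * cis t)))\<^sup>2) \<longlonglongrightarrow> (cmod (boundary_value f t))\<^sup>2"
      using AE_tendsto_boundary_value[OF H2]
    proof eventually_elim
      case (elim t)
      then show ?case using tendsto_power[OF tendsto_norm[OF tendsto_radii_boundary_value(1)]] by blast
    qed
  qed (auto simp: power_le_one fmeasurable_compact)
qed

lemma AE_boundary_value_power:
  assumes "f \<in> H2"
  shows "AE t in lborel. t \<in> {0..2*pi} \<longrightarrow> boundary_value (\<lambda>z. f z ^ k) t = boundary_value f t ^ k"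
  using AE_tendsto_boundary_value[OF assms]
proof eventually_elim
  case (elim t)
  then show ?case using tendsto_radii_boundary_value(2)[OF tendsto_power] by blast
qed

lemma AE_cmod_boundary_value_le:
  assumes f: "f holomorphic_on ball 0 1" and bound: "f ` ball 0 1 \<subseteq> cball 0 1"
  shows "AE t in lborel. t \<in> {0..2*pi} \<longrightarrow> cmod (boundary_value f t) \<le> 1"
  using AE_tendsto_boundary_value[OF H2_bounded(1)[OF f bound]]
proof eventually_elim
  case (elim t)
  have "of_real (radii n) * cis t \<in> ball 0 1" for n by (intro dilate_in_ball radii_bounds) simp
  then have "cmod (f (of_real (radii n) * cis t)) \<le> 1" for n
    using bound by (simp add: image_subset_iff del: mem_ball_0)
  then show ?case
    using elim LIMSEQ_le_const2[OF tendsto_norm[OF tendsto_radii_boundary_value(1)]] by blast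
qed

lemma h2_norm_square_power_eq_boundary:
  assumes f: "f holomorphic_on ball 0 1" and bound: "f ` ball 0 1 \<subseteq> cball 0 1"
  shows "(h2_norm (\<lambda>z. f z ^ k))\<^sup>2
    = (1 / (2 * pi)) * (LINT t:{0..2*pi}|lborel. (cmod (boundary_value f t) ^ k)\<^sup>2)"
proof -
  note power = bounded_by_1_power[OF f bound, of k]
  have "(h2_norm (\<lambda>z. f z ^ k))\<^sup>2
      = (1 / (2 * pi)) * (LINT t:{0..2*pi}|lborel. (cmod (boundary_value (\<lambda>z. f z ^ k) t))\<^sup>2)"
    by (rule h2_norm_square_eq_boundary[OF power])
  also have "(LINT t:{0..2*pi}|lborel. (cmod (boundary_value (\<lambda>z. f z ^ k) t))\<^sup>2)
      = (LINT t:{0..2*pi}|lborel. (cmod (boundary_value f t) ^ k)\<^sup>2)"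
  proof (rule set_lebesgue_integral_cong_AE)
    show "AE t\<in>{0..2*pi} in lborel.
        (cmod (boundary_value (\<lambda>z. f z ^ k) t))\<^sup>2 = (cmod (boundary_value f t) ^ k)\<^sup>2"
      using AE_boundary_value_power[OF H2_bounded(1)[OF f bound], of k]
      by eventually_elim (auto simp: norm_power)
  qed (use borel_measurable_boundary_value[OF f] borel_measurable_boundary_value[OF power(1)] in simp_all)
  finally show ?thesis .
qed

theorem h2_norm_power_tendsto:
  assumes f: "f holomorphic_on ball 0 1" and bound: "f ` ball 0 1 \<subseteq> cball 0 1"
  shows "(\<lambda>k. (h2_norm (\<lambda>z. f z ^ k))\<^sup>2) \<longlonglongrightarrow>
    measure lborel {t \<in> {0..2*pi}. cmod (boundary_value f t) = 1} / (2 * pi)"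
proof -
  define b where "b t = cmod (boundary_value f t)" for t
  define S where "S = {t. b t = 1}"
  have b [measurable]: "b \<in> borel_measurable borel"
    unfolding b_def using borel_measurable_boundary_value[OF f] by simp
  have S [measurable]: "S \<in> sets borel" unfolding S_def by measurable
  have b_le: "AE t in lborel. t \<in> {0..2*pi} \<longrightarrow> 0 \<le> b t \<and> b t \<le> 1"
    using AE_cmod_boundary_value_le[OF f bound] by eventually_elim (simp add: b_def)
  have "(\<lambda>k. LINT t:{0..2*pi}|lborel. (b t ^ k)\<^sup>2) \<longlonglongrightarrow> (LINT t:{0..2*pi}|lborel. indicator S t)"
  proof (rule set_integral_bounded_convergence[where B = 1])
    show "AE t in lborel. t \<in> {0..2*pi} \<longrightarrow> (\<lambda>k. (b t ^ k)\<^sup>2) \<longlonglongrightarrow> indicator S t"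
      using b_le
    proof eventually_elim
      case (elim t)
      show ?case
      proof (cases "b t = 1")
        case False
        then have "(\<lambda>k. (b t ^ k)\<^sup>2) \<longlonglongrightarrow> 0\<^sup>2" if "t \<in> {0..2*pi}"
          using elim that by (intro tendsto_intros LIMSEQ_realpow_zero) auto
        then show ?thesis using False by (simp add: S_def)
      qed (simp add: S_def)
    qed
    show "AE t in lborel. t \<in> {0..2*pi} \<longrightarrow> \<bar>(b t ^ k)\<^sup>2\<bar> \<le> 1" for k
      using b_le by eventually_elim (auto simp: power_le_one)
  qed (auto simp: fmeasurable_compact)
  also have "(LINT t:{0..2*pi}|lborel. indicator S t) = measure lborel {t \<in> {0..2*pi}. b t = 1}"
  proof -
    have "{t \<in> {0..2*pi}. b t = 1} = {0..2*pi} \<inter> S" by (auto simp: S_def)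
    then show ?thesis by (simp add: set_lebesgue_integral_def indicator_inter_arith[symmetric])
  qed
  finally have "(\<lambda>k. (1 / (2 * pi)) * (LINT t:{0..2*pi}|lborel. (b t ^ k)\<^sup>2))
      \<longlonglongrightarrow> (1 / (2 * pi)) * measure lborel {t \<in> {0..2*pi}. b t = 1}"
    by (intro tendsto_intros)
  then show ?thesis by (simp add: b_def h2_norm_square_power_eq_boundary[OF f bound])
qed

lemma radial_unimodular_iff:
  assumes "((\<lambda>r. f (of_real r * cis t)) \<longlongrightarrow> L) (at_left 1)"
  shows "radial_unimodular f t \<longleftrightarrow> cmod L = 1"
  unfolding radial_unimodular_def using assms tendsto_unique[OF trivial_limit_at_left_real assms] by metis

theorem h2_norm_power_tendsto_0_iff:
  assumes f: "f holomorphic_on ball 0 1" and bound: "f ` ball 0 1 \<subseteq> cball 0 1"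
  shows "(\<lambda>k. (h2_norm (\<lambda>z. f z ^ k))\<^sup>2) \<longlonglongrightarrow> 0 \<longleftrightarrow>
    (AE t in lborel. t \<in> {0..2*pi} \<longrightarrow> \<not> radial_unimodular f t)"
proof -
  define S where "S = {t \<in> {0..2*pi}. cmod (boundary_value f t) = 1}"
  have S_Int: "S = {0..2*pi} \<inter> {t. cmod (boundary_value f t) = 1}" by (auto simp: S_def)
  have S: "S \<in> sets lborel"
    unfolding S_Int using borel_measurable_boundary_value[OF f] by simp
  have S_fm: "S \<in> fmeasurable lborel"
    by (rule fmeasurableI2[OF _ _ S, of "{0..2*pi}"]) (auto simp: fmeasurable_compact S_def)
  have "(\<lambda>k. (h2_norm (\<lambda>z. f z ^ k))\<^sup>2) \<longlonglongrightarrow> 0 \<longleftrightarrow> measure lborel S / (2 * pi) = 0"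
    using h2_norm_power_tendsto[OF f bound] LIMSEQ_unique unfolding S_def[symmetric] by metis
  also have "\<dots> \<longleftrightarrow> measure lborel S = 0" by simp
  also have "\<dots> \<longleftrightarrow> S \<in> null_sets lborel"
    using S emeasure_eq_measure2[OF S_fm] by (simp add: null_sets_def)
  also have "\<dots> \<longleftrightarrow> (AE t in lborel. t \<notin> S)"
    using AE_iff_null_sets[OF S] .
  also have "\<dots> \<longleftrightarrow> (AE t in lborel. t \<in> {0..2*pi} \<longrightarrow> \<not> radial_unimodular f t)"
  proof (rule eventually_subst)
    show "AE t in lborel. t \<notin> S \<longleftrightarrow> (t \<in> {0..2*pi} \<longrightarrow> \<not> radial_unimodular f t)"
      using AE_tendsto_boundary_value[OF H2_bounded(1)[OF f bound]]
    proof eventually_elim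
      case (elim t)
      then show ?case using radial_unimodular_iff[of f t "boundary_value f t"] unfolding S_def by blast
    qed
  qed
  finally show ?thesis .
qed

section \<open>Necessity\<close>

lemma h2_norm_cong:
  assumes "\<And>z. z \<in> ball 0 1 \<Longrightarrow> f z = g z"
  shows "h2_norm f = h2_norm g"
proof -
  have "h2_mean f s = h2_mean g s" if "s \<in> {0..<1}" for s
    using that by (intro h2_mean_cong assms) auto
  then show ?thesis by (simp add: h2_norm_def)
qed

lemma h2_norm_tendsto_0_imp_pointwise:
  assumes "\<And>n. F n \<in> H2" "(\<lambda>n::nat. h2_norm (F n)) \<longlonglongrightarrow> 0" "cmod z < 1"
  shows "(\<lambda>n. F n z) \<longlonglongrightarrow> 0"
proof -
  have "(\<lambda>n. harnack_const z * (h2_norm (F n))\<^sup>2) \<longlonglongrightarrow> harnack_const z * 0\<^sup>2"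
    by (intro tendsto_intros assms)
  then have "(\<lambda>n. harnack_const z * (h2_norm (F n))\<^sup>2) \<longlonglongrightarrow> 0" by simp
  then have "(\<lambda>n. (cmod (F n z))\<^sup>2) \<longlonglongrightarrow> 0"
    by (rule Lim_null_comparison[rotated]) (use H2_point_evaluation[OF assms(1,3)] in simp)
  from tendsto_real_sqrt[OF this] show ?thesis by (simp add: tendsto_norm_zero_iff)
qed

lemma H2_power: "(\<lambda>z. z ^ n) \<in> H2" and h2_norm_power_le: "h2_norm (\<lambda>z. z ^ n) \<le> 1"
  by (intro H2_bounded holomorphic_intros; auto simp: norm_power power_le_one)+

lemma compact_wcomp_power_subseq:
  assumes \<phi>: "\<phi> holomorphic_on ball 0 1" "\<phi> ` ball 0 1 \<subseteq> ball 0 1"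
    and w: "w \<in> H2" and cpt: "compact_on_H2 (wcomp w \<phi>)"
  obtains \<sigma> :: "nat \<Rightarrow> nat" where "strict_mono \<sigma>" "(\<lambda>n. h2_norm (\<lambda>z. \<phi> z ^ \<sigma> n * w z)) \<longlonglongrightarrow> 0"
proof -
  obtain \<sigma> g where \<sigma>: "strict_mono \<sigma>" and g: "g \<in> H2"
    and lim: "(\<lambda>n. h2_norm (\<lambda>z. wcomp w \<phi> (\<lambda>z. z ^ \<sigma> n) z - g z)) \<longlonglongrightarrow> 0"
    using cpt[unfolded compact_on_H2_def, rule_format, of "\<lambda>n z. z ^ n"] H2_power h2_norm_power_le by auto
  define D where "D n z = \<phi> z ^ \<sigma> n * w z - g z" for n z
  have "\<phi> ` ball 0 1 \<subseteq> cball 0 1" using \<phi>(2) ball_subset_cball by blast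
  from H2_mult_bounded(1)[OF bounded_by_1_power[OF \<phi>(1) this] w]
  have D: "D n \<in> H2" for n unfolding D_def by (intro H2_diff g)
  have lim_D: "(\<lambda>n. h2_norm (D n)) \<longlonglongrightarrow> 0"
    using lim by (simp add: D_def[abs_def] wcomp_def mult.commute)
  have "g z = 0" if z: "z \<in> ball 0 1" for z
  proof -
    have "\<phi> z \<in> ball 0 1" using \<phi>(2) z by blast
    then have "(\<lambda>n. \<phi> z ^ \<sigma> n) \<longlonglongrightarrow> 0"
      using filterlim_compose[OF LIMSEQ_power_zero filterlim_subseq[OF \<sigma>]] by simp
    then have "(\<lambda>n. D n z) \<longlonglongrightarrow> 0 * w z - g z"
      unfolding D_def by (intro tendsto_intros)
    moreover have "(\<lambda>n. D n z) \<longlonglongrightarrow> 0"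
      using z by (intro h2_norm_tendsto_0_imp_pointwise D lim_D) simp
    ultimately show ?thesis using LIMSEQ_unique by fastforce
  qed
  then have "h2_norm (\<lambda>z. \<phi> z ^ \<sigma> n * w z) = h2_norm (D n)" for n
    by (intro h2_norm_cong) (simp add: D_def)
  then show thesis using that[OF \<sigma>] lim_D by simp
qed

lemma exp_mult_le_chord:
  fixes K x :: real
  assumes "0 \<le> x" "x \<le> 1"
  shows "exp (K * x) \<le> 1 + x * exp K"
proof -
  have "exp ((1 - x) *\<^sub>R 0 + x *\<^sub>R K) \<le> (1 - x) * exp 0 + x * exp K"
    by (rule convex_onD[OF exp_convex]) (use assms in auto)
  then show ?thesis using assms by (simp add: mult.commute)
qed

lemma cmod_mult_exp_half_square:
  "(cmod (a * exp (of_real (K / 2) * b)))\<^sup>2 = (cmod a)\<^sup>2 * exp (K * Re b)"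
  by (simp add: norm_mult power_mult_distrib exp_double[symmetric] mult.commute)

lemma holomorphic_point_evaluation:
  assumes h: "h holomorphic_on ball 0 R" "1 < R" and z: "cmod z < 1"
  shows "inverse (harnack_const z) * (cmod (h z))\<^sup>2 \<le> h2_mean h 1"
proof -
  note hol = holomorphic_on_subset_cball(1)[OF h] and cont = holomorphic_on_subset_cball(2)[OF h]
  have "(cmod (h z))\<^sup>2 \<le> poisson_integral (\<lambda>\<zeta>. (cmod (h \<zeta>))\<^sup>2) z"
    by (intro cmod_square_le_poisson_integral cont hol z) auto
  also have "\<dots> \<le> harnack_const z * circle_mean (\<lambda>\<zeta>. (cmod (h \<zeta>))\<^sup>2)"
    by (intro harnack_inequality(2) z continuous_intros cont) auto
  also have "circle_mean (\<lambda>\<zeta>. (cmod (h \<zeta>))\<^sup>2) = h2_mean h 1"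
    using h2_mean_eq_circle_mean[of 1 h] cont by simp
  finally show ?thesis
    using harnack_const_pos[OF z] by (simp add: field_simps)
qed

lemma h2_mean_exp_majorant_le:
  assumes cont: "continuous_on (sphere 0 1) w" "continuous_on (sphere 0 1) f" "continuous_on (sphere 0 1) q"
    and "0 \<le> K" and f: "\<And>\<zeta>. \<zeta> \<in> sphere 0 1 \<Longrightarrow> cmod (f \<zeta>) \<le> 1"
    and q: "\<And>\<zeta>. \<zeta> \<in> sphere 0 1 \<Longrightarrow> Re (q \<zeta>) \<le> (cmod (f \<zeta>))\<^sup>2 + 1 / (K + 1)"
  shows "h2_mean (\<lambda>\<zeta>. w \<zeta> * exp (of_real (K / 2) * q \<zeta>)) 1
    \<le> exp 1 * h2_mean w 1 + exp 1 * exp K * h2_mean (\<lambda>\<zeta>. f \<zeta> * w \<zeta>) 1"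
proof (rule h2_mean_le_linear)
  fix \<zeta> :: complex assume \<zeta>: "cmod \<zeta> = 1"
  define x where "x = (cmod (f \<zeta>))\<^sup>2"
  have x: "0 \<le> x" "x \<le> 1" using f[of \<zeta>] \<zeta> by (auto simp: x_def intro!: power_le_one)
  have "K * Re (q \<zeta>) \<le> K * (x + 1 / (K + 1))"
    using q[of \<zeta>] \<zeta> \<open>0 \<le> K\<close> by (intro mult_left_mono) (auto simp: x_def)
  also have "\<dots> \<le> K * x + 1" using \<open>0 \<le> K\<close> by (simp add: distrib_left)
  finally have "exp (K * Re (q \<zeta>)) \<le> exp (K * x) * exp 1" by (simp flip: exp_add)
  also have "\<dots> \<le> (1 + x * exp K) * exp 1" by (intro mult_right_mono exp_mult_le_chord x) auto
  finally have "(cmod (w \<zeta>))\<^sup>2 * exp (K * Re (q \<zeta>)) \<le> (cmod (w \<zeta>))\<^sup>2 * ((1 + x * exp K) * exp 1)"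
    by (intro mult_left_mono) auto
  then show "(cmod (w \<zeta> * exp (of_real (K / 2) * q \<zeta>)))\<^sup>2
      \<le> exp 1 * (cmod (w \<zeta>))\<^sup>2 + exp 1 * exp K * (cmod (f \<zeta> * w \<zeta>))\<^sup>2"
    unfolding cmod_mult_exp_half_square by (simp add: x_def norm_mult power_mult_distrib algebra_simps)
qed (auto intro!: continuous_intros cont)

text \<open>With \<open>Re q\<close> a harmonic majorant of \<open>\<bar>f\<bar>\<^sup>2\<close>, point evaluation of \<open>w * exp (K q / 2)\<close> gains
  the factor \<open>exp (K Re q)\<close> on the left, while on the right it only costs \<open>exp K\<close> on the part of
  the mean weighted by \<open>\<bar>f\<bar>\<^sup>2\<close>.\<close>

lemma weight_lower_bound_closed_disk:
  fixes K :: real and z :: complex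
  assumes w: "w holomorphic_on ball 0 R" and f: "f holomorphic_on ball 0 R" "f ` cball 0 1 \<subseteq> cball 0 1"
    and "1 < R" "0 \<le> K" and z: "cmod z < 1"
  defines "c \<equiv> inverse (harnack_const z)"
  shows "c * ((cmod (w z))\<^sup>2 * exp (K * (c * h2_mean f 1)))
    \<le> exp 1 * (h2_mean w 1 + exp K * h2_mean (\<lambda>z. f z * w z) 1)"
proof -
  have cont: "continuous_on (sphere 0 1) w" "continuous_on (sphere 0 1) f"
    by (rule holomorphic_on_subset_cball(2)[OF _ \<open>1 < R\<close> sphere_cball], fact)+
  have c: "0 \<le> c" using harnack_const_pos[OF z] by (simp add: c_def)
  have "0 < 1 / (K + 1)" using \<open>0 \<le> K\<close> by simp
  then obtain q where q: "q holomorphic_on UNIV" "\<And>\<zeta>. \<zeta> \<in> cball 0 1 \<Longrightarrow> (cmod (f \<zeta>))\<^sup>2 \<le> Re (q \<zeta>)"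
    "\<And>\<zeta>. \<zeta> \<in> sphere 0 1 \<Longrightarrow> Re (q \<zeta>) \<le> (cmod (f \<zeta>))\<^sup>2 + 1 / (K + 1)"
    by (rule holomorphic_harmonic_majorant[OF f(1) \<open>1 < R\<close>]) blast
  note hol_q = holomorphic_on_subset[OF q(1) subset_UNIV]
  note cont_q = holomorphic_on_imp_continuous_on[OF hol_q]
  define H where "H \<zeta> = w \<zeta> * exp (of_real (K / 2) * q \<zeta>)" for \<zeta>
  have H: "H holomorphic_on ball 0 R"
    unfolding H_def by (intro holomorphic_intros w hol_q)
  have "c * h2_mean f 1 \<le> c * Re (q 0)"
    by (intro mult_left_mono harmonic_majorant_at_0(1) cont q c) auto
  also have "\<dots> \<le> Re (q z)"
    unfolding c_def using z by (intro harnack_Re(1) cont_q hol_q) (auto intro: order_trans[OF _ q(2)])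
  finally have "exp (K * (c * h2_mean f 1)) \<le> exp (K * Re (q z))"
    using \<open>0 \<le> K\<close> by (simp add: mult_left_mono)
  then have "c * ((cmod (w z))\<^sup>2 * exp (K * (c * h2_mean f 1))) \<le> c * (cmod (H z))\<^sup>2"
    unfolding H_def cmod_mult_exp_half_square using c by (intro mult_left_mono) auto
  also have "\<dots> \<le> h2_mean H 1"
    unfolding c_def by (rule holomorphic_point_evaluation[OF H \<open>1 < R\<close> z])
  also have "\<dots> \<le> exp 1 * h2_mean w 1 + exp 1 * exp K * h2_mean (\<lambda>z. f z * w z) 1"
    unfolding H_def
    by (rule h2_mean_exp_majorant_le[OF cont cont_q \<open>0 \<le> K\<close> _ q(3)])
       (use f(2) in \<open>auto simp: image_subset_iff\<close>)
  finally show ?thesis by (simp add: distrib_left)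
qed

lemma weight_lower_bound_dilate:
  fixes K :: real and z :: complex
  assumes w: "w \<in> H2" and f: "f holomorphic_on ball 0 1" "f ` ball 0 1 \<subseteq> cball 0 1"
    and K: "0 \<le> K" and z: "cmod z < 1" and s: "0 \<le> s" "s < 1"
  defines "c \<equiv> inverse (harnack_const z)"
  shows "c * ((cmod (w (of_real s * z)))\<^sup>2 * exp (K * (c * h2_mean f s)))
    \<le> exp 1 * ((h2_norm w)\<^sup>2 + exp K * (h2_norm (\<lambda>z. f z * w z))\<^sup>2)"
proof -
  obtain S where S: "1 < S" "(\<lambda>z. w (of_real s * z)) holomorphic_on ball 0 S"
    by (rule holomorphic_on_dilate[OF H2_holomorphic[OF w] s])
  obtain T where T: "1 < T" "(\<lambda>z. f (of_real s * z)) holomorphic_on ball 0 T"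
    by (rule holomorphic_on_dilate[OF f(1) s])
  have maps: "(\<lambda>z. f (of_real s * z)) ` cball 0 1 \<subseteq> cball 0 1"
    using dilate_in_ball[OF s] f(2) by blast
  have hol: "(\<lambda>z. w (of_real s * z)) holomorphic_on ball 0 (min S T)"
    "(\<lambda>z. f (of_real s * z)) holomorphic_on ball 0 (min S T)"
    by (rule holomorphic_on_subset[OF S(2)] holomorphic_on_subset[OF T(2)], force)+
  have "c * ((cmod (w (of_real s * z)))\<^sup>2 * exp (K * (c * h2_mean f s)))
      \<le> exp 1 * (h2_mean w s + exp K * h2_mean (\<lambda>z. f z * w z) s)"
    using weight_lower_bound_closed_disk[OF hol maps _ K z] S(1) T(1) h2_mean_dilate[of "\<lambda>z. f z * w z" s 1]
    by (simp add: h2_mean_dilate c_def)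
  also have "\<dots> \<le> exp 1 * ((h2_norm w)\<^sup>2 + exp K * (h2_norm (\<lambda>z. f z * w z))\<^sup>2)"
    by (intro mult_left_mono add_mono h2_mean_le_norm w H2_mult_bounded(1)[OF f w] s) auto
  finally show ?thesis .
qed

lemma weight_lower_bound:
  fixes K :: real and z :: complex
  assumes w: "w \<in> H2" and f: "f holomorphic_on ball 0 1" "f ` ball 0 1 \<subseteq> cball 0 1"
    and K: "0 \<le> K" and z: "cmod z < 1"
  defines "c \<equiv> inverse (harnack_const z)"
  shows "c * ((cmod (w z))\<^sup>2 * exp (K * (c * (h2_norm f)\<^sup>2)))
    \<le> exp 1 * ((h2_norm w)\<^sup>2 + exp K * (h2_norm (\<lambda>z. f z * w z))\<^sup>2)"
proof (rule tendsto_upperbound)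
  have "isCont w (of_real 1 * z)" using z by (intro H2_isCont[OF w]) simp
  then have "((\<lambda>s. w (of_real s * z)) \<longlongrightarrow> w (of_real 1 * z)) (at_left 1)"
    by (rule isCont_tendsto_compose) (intro tendsto_intros)
  then have "((\<lambda>s. w (of_real s * z)) \<longlongrightarrow> w z) (at_left 1)" by simp
  then show "((\<lambda>s. c * ((cmod (w (of_real s * z)))\<^sup>2 * exp (K * (c * h2_mean f s))))
      \<longlongrightarrow> c * ((cmod (w z))\<^sup>2 * exp (K * (c * (h2_norm f)\<^sup>2)))) (at_left 1)"
    by (intro tendsto_intros h2_mean_tendsto_norm H2_bounded(1)[OF f])
  show "\<forall>\<^sub>F s in at_left 1. c * ((cmod (w (of_real s * z)))\<^sup>2 * exp (K * (c * h2_mean f s)))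
      \<le> exp 1 * ((h2_norm w)\<^sup>2 + exp K * (h2_norm (\<lambda>z. f z * w z))\<^sup>2)"
    using eventually_unit_interval_at_left unfolding c_def
    by eventually_elim (intro weight_lower_bound_dilate w f K z, auto)
qed simp

lemma exp_mult_bounded_imp_nonpos:
  fixes a b M :: real
  assumes "0 < a" and bound: "\<And>K. 0 \<le> K \<Longrightarrow> a * exp (K * b) \<le> M"
  shows "b \<le> 0"
proof (rule ccontr)
  assume "\<not> b \<le> 0"
  have "a \<le> M" using bound[of 0] by simp
  define K where "K = M / a / b"
  have K: "0 \<le> K" using \<open>0 < a\<close> \<open>a \<le> M\<close> \<open>\<not> b \<le> 0\<close> by (simp add: K_def)
  have "M < a * (1 + K * b)" using \<open>0 < a\<close> \<open>\<not> b \<le> 0\<close> by (simp add: K_def distrib_left)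
  also have "\<dots> \<le> a * exp (K * b)"
    using \<open>0 < a\<close> by (intro mult_left_mono exp_ge_add_one_self) auto
  also have "\<dots> \<le> M" by (rule bound[OF K])
  finally show False by simp
qed

theorem compact_wcomp_imp_power_norms_tendsto_0:
  assumes \<phi>: "\<phi> holomorphic_on ball 0 1" "\<phi> ` ball 0 1 \<subseteq> ball 0 1"
    and w: "w \<in> H2" "z \<in> ball 0 1" "w z \<noteq> 0" and cpt: "compact_on_H2 (wcomp w \<phi>)"
  shows "(\<lambda>k. (h2_norm (\<lambda>z. \<phi> z ^ k))\<^sup>2) \<longlonglongrightarrow> 0"
proof -
  have bound: "\<phi> ` ball 0 1 \<subseteq> cball 0 1" using \<phi>(2) ball_subset_cball by blast
  define c where "c = inverse (harnack_const z)"
  have z: "cmod z < 1" and c: "0 < c" using w(2) harnack_const_pos by (auto simp: c_def)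
  obtain L where L: "(\<lambda>k. (h2_norm (\<lambda>z. \<phi> z ^ k))\<^sup>2) \<longlonglongrightarrow> L"
    using h2_norm_power_tendsto[OF \<phi>(1) bound] by blast
  obtain \<sigma> :: "nat \<Rightarrow> nat" where \<sigma>: "strict_mono \<sigma>"
    and lim: "(\<lambda>n. h2_norm (\<lambda>z. \<phi> z ^ \<sigma> n * w z)) \<longlonglongrightarrow> 0"
    by (rule compact_wcomp_power_subseq[OF \<phi> w(1) cpt])
  have limit: "c * (cmod (w z))\<^sup>2 * exp (K * (c * L)) \<le> exp 1 * ((h2_norm w)\<^sup>2 + exp K * 0\<^sup>2)"
    if K: "0 \<le> K" for K
  proof (rule LIMSEQ_le)
    show "(\<lambda>n. c * (cmod (w z))\<^sup>2 * exp (K * (c * (h2_norm (\<lambda>z. \<phi> z ^ \<sigma> n))\<^sup>2)))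
        \<longlonglongrightarrow> c * (cmod (w z))\<^sup>2 * exp (K * (c * L))"
      by (intro tendsto_intros filterlim_compose[OF L filterlim_subseq[OF \<sigma>]])
    show "(\<lambda>n. exp 1 * ((h2_norm w)\<^sup>2 + exp K * (h2_norm (\<lambda>z. \<phi> z ^ \<sigma> n * w z))\<^sup>2))
        \<longlonglongrightarrow> exp 1 * ((h2_norm w)\<^sup>2 + exp K * 0\<^sup>2)"
      by (intro tendsto_intros lim)
    from weight_lower_bound[OF w(1) bounded_by_1_power[OF \<phi>(1) bound] K z]
    show "\<exists>N. \<forall>n\<ge>N. c * (cmod (w z))\<^sup>2 * exp (K * (c * (h2_norm (\<lambda>z. \<phi> z ^ \<sigma> n))\<^sup>2))
        \<le> exp 1 * ((h2_norm w)\<^sup>2 + exp K * (h2_norm (\<lambda>z. \<phi> z ^ \<sigma> n * w z))\<^sup>2)"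
      by (simp add: c_def mult.assoc)
  qed
  have "c * L \<le> 0"
  proof (rule exp_mult_bounded_imp_nonpos)
    show "0 < c * (cmod (w z))\<^sup>2" using c w(3) by simp
    show "c * (cmod (w z))\<^sup>2 * exp (K * (c * L)) \<le> exp 1 * (h2_norm w)\<^sup>2" if "0 \<le> K" for K
      using limit[OF that] by simp
  qed
  then have "L \<le> 0" using c by (simp add: mult_le_0_iff)
  moreover have "0 \<le> L" by (rule LIMSEQ_le_const[OF L]) simp
  ultimately show ?thesis using L by simp
qed

section \<open>Sufficiency\<close>

lemma Montel_unit_ball:
  fixes v :: "nat \<Rightarrow> complex \<Rightarrow> complex"
  assumes "\<And>n. v n holomorphic_on ball 0 1" "\<And>n. v n ` ball 0 1 \<subseteq> cball 0 1"
  obtains g r where "g holomorphic_on ball 0 1" "strict_mono (r :: nat \<Rightarrow> nat)"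
    "\<And>z. z \<in> ball 0 1 \<Longrightarrow> (\<lambda>n. v (r n) z) \<longlonglongrightarrow> g z"
proof (rule Montel[of "ball 0 1" "range v" v])
  show "h holomorphic_on ball 0 1" if "h \<in> range v" for h
    using that assms(1) by auto
  show "\<exists>B. \<forall>h\<in>range v. \<forall>z\<in>K. cmod (h z) \<le> B" if "compact K" "K \<subseteq> ball 0 1" for K
    using that(2) assms(2) by (intro exI[of _ 1]) (fastforce simp: image_subset_iff)
qed (auto intro: that)

lemma ex_weight_dominated_closed_disk:
  assumes F: "F holomorphic_on ball 0 R" "1 < R" and "0 < e"
  obtains v where "v holomorphic_on ball 0 1" "\<And>z. z \<in> ball 0 1 \<Longrightarrow> cmod (v z) \<le> exp (- (cmod (F z))\<^sup>2)"
    "exp (- (h2_mean F 1 + e)) \<le> cmod (v 0)"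
proof -
  obtain q where q: "q holomorphic_on UNIV" "\<And>z. z \<in> cball 0 1 \<Longrightarrow> (cmod (F z))\<^sup>2 \<le> Re (q z)"
    "\<And>z. z \<in> sphere 0 1 \<Longrightarrow> Re (q z) \<le> (cmod (F z))\<^sup>2 + e"
    by (rule holomorphic_harmonic_majorant[OF F \<open>0 < e\<close>]) blast
  show thesis
  proof (rule that[of "\<lambda>z. exp (- q z)"])
    show "(\<lambda>z. exp (- q z)) holomorphic_on ball 0 1"
      by (intro holomorphic_intros holomorphic_on_subset[OF q(1)]) auto
    show "cmod (exp (- q z)) \<le> exp (- (cmod (F z))\<^sup>2)" if "z \<in> ball 0 1" for z
      using q(2)[of z] that by simp
    have "continuous_on (sphere 0 1) F"
      by (rule holomorphic_on_subset_cball(2)[OF F sphere_cball])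
    from harmonic_majorant_at_0(2)[OF this q(1,3)]
    show "exp (- (h2_mean F 1 + e)) \<le> cmod (exp (- q 0))" by simp
  qed
qed

lemma ex_weight_dominated_dilate:
  assumes f: "f \<in> H2" and s: "0 \<le> s" "s < 1" and "0 < e"
  shows "\<exists>v. v holomorphic_on ball 0 1 \<and>
      (\<forall>z\<in>ball 0 1. cmod (v z) \<le> exp (- (cmod (f (of_real s * z)))\<^sup>2)) \<and>
      exp (- ((h2_norm f)\<^sup>2 + e)) \<le> cmod (v 0)"
proof -
  obtain T where T: "1 < T" "(\<lambda>z. f (of_real s * z)) holomorphic_on ball 0 T"
    by (rule holomorphic_on_dilate[OF H2_holomorphic[OF f] s])
  obtain v where v: "v holomorphic_on ball 0 1"
    "\<And>z. z \<in> ball 0 1 \<Longrightarrow> cmod (v z) \<le> exp (- (cmod (f (of_real s * z)))\<^sup>2)"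
    "exp (- (h2_mean (\<lambda>z. f (of_real s * z)) 1 + e)) \<le> cmod (v 0)"
    by (rule ex_weight_dominated_closed_disk[OF T(2,1) \<open>0 < e\<close>]) blast
  have "exp (- ((h2_norm f)\<^sup>2 + e)) \<le> exp (- (h2_mean f s + e))"
    using h2_mean_le_norm[OF f s] by simp
  also have "\<dots> \<le> cmod (v 0)" using v(3) by (simp add: h2_mean_dilate)
  finally show ?thesis using v(1,2) by blast
qed

text \<open>Montel's theorem replaces the boundary values of \<open>f\<close>: the weight is a limit of weights for its dilates.\<close>

lemma ex_weight_dominated:
  assumes f: "f \<in> H2"
  obtains v where "v holomorphic_on ball 0 1" "\<And>z. z \<in> ball 0 1 \<Longrightarrow> cmod (v z) \<le> exp (- (cmod (f z))\<^sup>2)"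
    "exp (- (h2_norm f)\<^sup>2) \<le> cmod (v 0)"
proof -
  have "\<exists>v. v holomorphic_on ball 0 1 \<and>
      (\<forall>z\<in>ball 0 1. cmod (v z) \<le> exp (- (cmod (f (of_real (radii n) * z)))\<^sup>2)) \<and>
      exp (- ((h2_norm f)\<^sup>2 + inverse (real (Suc n)))) \<le> cmod (v 0)" for n
    by (rule ex_weight_dominated_dilate[OF f radii_bounds]) simp
  then obtain v where v: "\<And>n. v n holomorphic_on ball 0 1"
    "\<And>n z. z \<in> ball 0 1 \<Longrightarrow> cmod (v n z) \<le> exp (- (cmod (f (of_real (radii n) * z)))\<^sup>2)"
    "\<And>n. exp (- ((h2_norm f)\<^sup>2 + inverse (real (Suc n)))) \<le> cmod (v n 0)"
    by metis
  have "v n ` ball 0 1 \<subseteq> cball 0 1" for n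
    using v(2) by (fastforce intro: order_trans)
  then obtain g r where g: "g holomorphic_on ball 0 1" and r: "strict_mono (r :: nat \<Rightarrow> nat)"
    and lim: "\<And>z. z \<in> ball 0 1 \<Longrightarrow> (\<lambda>n. v (r n) z) \<longlonglongrightarrow> g z"
    by (rule Montel_unit_ball[of v, OF v(1)]) blast
  show thesis
  proof (rule that[OF g])
    fix z :: complex assume z: "z \<in> ball 0 1"
    have "isCont f (of_real 1 * z)" using z by (intro H2_isCont[OF f]) simp
    then have "(\<lambda>n. f (of_real (radii (r n)) * z)) \<longlonglongrightarrow> f (of_real 1 * z)"
      by (rule isCont_tendsto_compose)
         (intro tendsto_intros filterlim_compose[OF radii_tendsto filterlim_subseq[OF r]])
    then have "(\<lambda>n. exp (- (cmod (f (of_real (radii (r n)) * z)))\<^sup>2)) \<longlonglongrightarrow> exp (- (cmod (f (of_real 1 * z)))\<^sup>2)"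
      by (intro tendsto_intros)
    then show "cmod (g z) \<le> exp (- (cmod (f z))\<^sup>2)"
      using LIMSEQ_le[OF tendsto_norm[OF lim[OF z]]] v(2)[OF z] by auto
  next
    have "(\<lambda>n. exp (- ((h2_norm f)\<^sup>2 + inverse (real (Suc (r n)))))) \<longlonglongrightarrow> exp (- ((h2_norm f)\<^sup>2 + 0))"
      by (intro tendsto_intros filterlim_compose[OF LIMSEQ_inverse_real_of_nat filterlim_subseq[OF r]])
    then show "exp (- (h2_norm f)\<^sup>2) \<le> cmod (g 0)"
      using LIMSEQ_le[OF _ tendsto_norm[OF lim[of 0]]] v(3) by auto
  qed
qed

lemma prod_exp_uminus:
  fixes a :: "'a \<Rightarrow> real"
  assumes "finite A"
  shows "(\<Prod>j\<in>A. exp (- a j)) = exp (- (\<Sum>j\<in>A. a j))"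
  using assms by (simp add: exp_sum sum_negf[symmetric])

lemma Montel_decreasing_bounds:
  fixes P :: "nat \<Rightarrow> complex \<Rightarrow> complex"
  assumes hol: "\<And>n. P n holomorphic_on ball 0 1"
    and le: "\<And>m n z. z \<in> ball 0 1 \<Longrightarrow> n \<le> m \<Longrightarrow> cmod (P m z) \<le> b n z" and b0: "\<And>z. b 0 z \<le> 1"
    and ge: "\<And>n. d \<le> cmod (P n 0)"
  obtains w where "w holomorphic_on ball 0 1" "d \<le> cmod (w 0)"
    "\<And>z n. z \<in> ball 0 1 \<Longrightarrow> cmod (w z) \<le> b n z"
proof -
  have "P n ` ball 0 1 \<subseteq> cball 0 1" for n
    using order_trans[OF le b0] by auto
  then obtain w r where w: "w holomorphic_on ball 0 1" and r: "strict_mono (r :: nat \<Rightarrow> nat)"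
    and lim: "\<And>z. z \<in> ball 0 1 \<Longrightarrow> (\<lambda>m. P (r m) z) \<longlonglongrightarrow> w z"
    by (rule Montel_unit_ball[of P, OF hol]) blast
  show thesis
  proof (rule that[OF w])
    show "d \<le> cmod (w 0)"
      using ge by (intro LIMSEQ_le_const[OF tendsto_norm[OF lim]]) auto
    fix z :: complex and n assume z: "z \<in> ball 0 1"
    have "eventually (\<lambda>m. n \<le> r m) sequentially"
      using filterlim_subseq[OF r] by (simp add: filterlim_at_top)
    then show "cmod (w z) \<le> b n z"
      by (intro tendsto_upperbound[OF tendsto_norm[OF lim[OF z]]])
         (auto elim!: eventually_mono intro: le[OF z])
  qed
qed

lemma ex_weight_dominated_sum:
  fixes f :: "nat \<Rightarrow> complex \<Rightarrow> complex"
  assumes f: "\<And>j. f j \<in> H2" and sum: "\<And>n. (\<Sum>j<n. (h2_norm (f j))\<^sup>2) \<le> M"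
  obtains w where "w holomorphic_on ball 0 1" "w 0 \<noteq> 0"
    "\<And>z n. z \<in> ball 0 1 \<Longrightarrow> cmod (w z) \<le> exp (- (\<Sum>j<n. (cmod (f j z))\<^sup>2))"
proof -
  have "\<exists>v. v holomorphic_on ball 0 1 \<and> (\<forall>z\<in>ball 0 1. cmod (v z) \<le> exp (- (cmod (f j z))\<^sup>2)) \<and>
      exp (- (h2_norm (f j))\<^sup>2) \<le> cmod (v 0)" for j
    by (rule ex_weight_dominated[OF f[of j]]) blast
  then obtain v where v: "\<And>j. v j holomorphic_on ball 0 1"
    "\<And>j z. z \<in> ball 0 1 \<Longrightarrow> cmod (v j z) \<le> exp (- (cmod (f j z))\<^sup>2)"
    "\<And>j. exp (- (h2_norm (f j))\<^sup>2) \<le> cmod (v j 0)"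
    by metis
  define P where "P n z = (\<Prod>j<n. v j z)" for n z
  have P_hol: "P n holomorphic_on ball 0 1" for n
    unfolding P_def by (intro holomorphic_intros v)
  have P_le: "cmod (P m z) \<le> exp (- (\<Sum>j<n. (cmod (f j z))\<^sup>2))" if "z \<in> ball 0 1" "n \<le> m" for m n z
  proof -
    have "cmod (P m z) \<le> exp (- (\<Sum>j<m. (cmod (f j z))\<^sup>2))"
      unfolding P_def prod_norm[symmetric] prod_exp_uminus[OF finite_lessThan, symmetric]
      by (intro prod_mono) (simp add: v(2)[OF that(1)])
    also have "\<dots> \<le> exp (- (\<Sum>j<n. (cmod (f j z))\<^sup>2))"
      using that(2) by (auto intro!: sum_mono2)
    finally show ?thesis .
  qed
  have P_ge: "exp (- M) \<le> cmod (P n 0)" for n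
  proof -
    have "exp (- M) \<le> exp (- (\<Sum>j<n. (h2_norm (f j))\<^sup>2))" using sum by simp
    also have "\<dots> \<le> cmod (P n 0)"
      unfolding P_def prod_norm[symmetric] prod_exp_uminus[OF finite_lessThan, symmetric]
      by (intro prod_mono) (simp add: v(3))
    finally show ?thesis .
  qed
  obtain w where w: "w holomorphic_on ball 0 1" "exp (- M) \<le> cmod (w 0)"
    "\<And>z n. z \<in> ball 0 1 \<Longrightarrow> cmod (w z) \<le> exp (- (\<Sum>j<n. (cmod (f j z))\<^sup>2))"
    by (rule Montel_decreasing_bounds[of P, OF P_hol P_le _ P_ge]) auto
  have "w 0 \<noteq> 0" using w(2) exp_gt_zero[of "- M"] by auto
  then show thesis by (rule that[OF w(1) _ w(3)])
qed

definition vanishes_at_contact :: "(complex \<Rightarrow> complex) \<Rightarrow> (complex \<Rightarrow> complex) \<Rightarrow> bool" where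
  "vanishes_at_contact w \<phi> \<longleftrightarrow>
    (\<forall>\<eta>>0. \<exists>\<rho><1. \<forall>z\<in>ball 0 1. \<rho> < cmod (\<phi> z) \<longrightarrow> cmod (w z) \<le> \<eta>)"

lemma vanishes_at_contact_if_dominated:
  fixes k :: "nat \<Rightarrow> nat"
  assumes \<phi>: "\<phi> ` ball 0 1 \<subseteq> ball 0 1"
    and w: "\<And>z n. z \<in> ball 0 1 \<Longrightarrow> cmod (w z) \<le> exp (- (\<Sum>j<n. (cmod (\<phi> z ^ k j))\<^sup>2))"
  shows "vanishes_at_contact w \<phi>"
  unfolding vanishes_at_contact_def
proof (intro allI impI)
  fix \<eta> :: real assume "0 < \<eta>"
  obtain n :: nat where n: "- ln \<eta> < real n" using reals_Archimedean2 by blast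
  have "((\<lambda>x. \<Sum>j<n. (x ^ k j)\<^sup>2) \<longlongrightarrow> (\<Sum>j<n. (1 ^ k j)\<^sup>2)) (at_left (1::real))"
    by (intro tendsto_intros)
  then have "eventually (\<lambda>x. - ln \<eta> < (\<Sum>j<n. (x ^ k j)\<^sup>2)) (at_left (1::real))"
    by (rule order_tendstoD(1)) (use n in simp)
  then obtain \<rho> where \<rho>: "\<rho> < 1" "\<And>x. \<rho> < x \<Longrightarrow> x < 1 \<Longrightarrow> - ln \<eta> < (\<Sum>j<n. (x ^ k j)\<^sup>2)"
    unfolding eventually_at_left_field by auto
  show "\<exists>\<rho><1. \<forall>z\<in>ball 0 1. \<rho> < cmod (\<phi> z) \<longrightarrow> cmod (w z) \<le> \<eta>"
  proof (intro exI[of _ \<rho>] conjI ballI impI \<rho>(1))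
    fix z :: complex assume z: "z \<in> ball 0 1" "\<rho> < cmod (\<phi> z)"
    then have "cmod (\<phi> z) < 1" using \<phi> by (auto simp: image_subset_iff)
    then have "- ln \<eta> < (\<Sum>j<n. (cmod (\<phi> z ^ k j))\<^sup>2)"
      using \<rho>(2)[OF z(2)] by (simp add: norm_power)
    then have "exp (- (\<Sum>j<n. (cmod (\<phi> z ^ k j))\<^sup>2)) \<le> exp (ln \<eta>)" by simp
    then show "cmod (w z) \<le> \<eta>" using w[OF z(1), of n] \<open>0 < \<eta>\<close> by simp
  qed
qed

lemma ex_weight_vanishing:
  assumes \<phi>: "\<phi> holomorphic_on ball 0 1" "\<phi> ` ball 0 1 \<subseteq> ball 0 1"
    and norms: "(\<lambda>k. (h2_norm (\<lambda>z. \<phi> z ^ k))\<^sup>2) \<longlonglongrightarrow> 0"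
  obtains w where "w holomorphic_on ball 0 1" "w ` ball 0 1 \<subseteq> cball 0 1" "w 0 \<noteq> 0" "vanishes_at_contact w \<phi>"
proof -
  have "\<exists>k. (h2_norm (\<lambda>z. \<phi> z ^ k))\<^sup>2 < (1/2) ^ j" for j :: nat
    using order_tendstoD(2)[OF norms, of "(1/2) ^ j"] by (auto simp: eventually_sequentially)
  then obtain k where k: "\<And>j::nat. (h2_norm (\<lambda>z. \<phi> z ^ k j))\<^sup>2 < (1/2) ^ j" by metis
  have "\<phi> ` ball 0 1 \<subseteq> cball 0 1" using \<phi>(2) ball_subset_cball by blast
  note power = H2_bounded(1)[OF bounded_by_1_power[OF \<phi>(1) this]]
  have sum: "(\<Sum>j<n. (h2_norm (\<lambda>z. \<phi> z ^ k j))\<^sup>2) \<le> 2" for n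
  proof -
    have "(\<Sum>j<n. (h2_norm (\<lambda>z. \<phi> z ^ k j))\<^sup>2) \<le> (\<Sum>j<n. (1/2) ^ j)"
      by (intro sum_mono less_imp_le k)
    also have "\<dots> \<le> 2" by (simp add: sum_gp_strict)
    finally show ?thesis .
  qed
  obtain w where w: "w holomorphic_on ball 0 1" "w 0 \<noteq> 0"
    "\<And>z n. z \<in> ball 0 1 \<Longrightarrow> cmod (w z) \<le> exp (- (\<Sum>j<n. (cmod (\<phi> z ^ k j))\<^sup>2))"
    by (rule ex_weight_dominated_sum[OF power sum]) blast
  show thesis
  proof (rule that[OF w(1) _ w(2)])
    show "w ` ball 0 1 \<subseteq> cball 0 1" using w(3)[of _ 0] by auto
    show "vanishes_at_contact w \<phi>" by (rule vanishes_at_contact_if_dominated[OF \<phi>(2) w(3)])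
  qed
qed

lemma wcomp_in_H2:
  assumes \<phi>: "\<phi> holomorphic_on ball 0 1" "\<phi> ` ball 0 1 \<subseteq> ball 0 1"
    and w: "w holomorphic_on ball 0 1" "w ` ball 0 1 \<subseteq> cball 0 1" and f: "f \<in> H2"
  shows "wcomp w \<phi> f \<in> H2"
  unfolding wcomp_def by (rule H2_mult_bounded(1)[OF w littlewood_subordination(1)[OF f \<phi>]])

lemma bounded_on_H2_wcomp:
  assumes \<phi>: "\<phi> holomorphic_on ball 0 1" "\<phi> ` ball 0 1 \<subseteq> ball 0 1"
    and w: "w holomorphic_on ball 0 1" "w ` ball 0 1 \<subseteq> cball 0 1"
  shows "bounded_on_H2 (wcomp w \<phi>)"
proof -
  define C where "C = harnack_const (\<phi> 0)"
  have "h2_norm (wcomp w \<phi> f) \<le> sqrt C * h2_norm f" if f: "f \<in> H2" for f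
  proof -
    have "h2_norm (wcomp w \<phi> f) \<le> h2_norm (\<lambda>z. f (\<phi> z))"
      unfolding wcomp_def by (rule H2_mult_bounded(2)[OF w littlewood_subordination(1)[OF f \<phi>]])
    also have "\<dots> \<le> sqrt (C * (h2_norm f)\<^sup>2)"
      unfolding C_def by (rule real_le_rsqrt[OF littlewood_subordination(2)[OF f \<phi>]])
    also have "\<dots> = sqrt C * h2_norm f" using h2_norm_nonneg[OF f] by (simp add: real_sqrt_mult)
    finally show ?thesis .
  qed
  then show ?thesis unfolding bounded_on_H2_def using wcomp_in_H2[OF \<phi> w] by blast
qed

lemma H2_locally_bounded:
  assumes "compact K" "K \<subseteq> ball 0 1"
  obtains B where "\<And>f z. f \<in> H2 \<Longrightarrow> z \<in> K \<Longrightarrow> cmod (f z) \<le> B * h2_norm f"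
proof -
  have "continuous_on K (\<lambda>z. sqrt (harnack_const z))"
    unfolding harnack_const_def using assms(2) by (intro continuous_intros) auto
  then have "bounded ((\<lambda>z. sqrt (harnack_const z)) ` K)"
    using assms(1) by (intro compact_imp_bounded compact_continuous_image)
  then obtain B where B: "\<And>z. z \<in> K \<Longrightarrow> \<bar>sqrt (harnack_const z)\<bar> \<le> B"
    by (auto simp: bounded_iff)
  show thesis
  proof (rule that)
    fix f z assume f: "f \<in> H2" and z: "z \<in> K"
    have "cmod z < 1" using z assms(2) by auto
    then have "cmod (f z) \<le> sqrt (harnack_const z * (h2_norm f)\<^sup>2)"
      by (intro real_le_rsqrt H2_point_evaluation f)
    also have "\<dots> = sqrt (harnack_const z) * h2_norm f"
      using h2_norm_nonneg[OF f] by (simp add: real_sqrt_mult)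
    also have "\<dots> \<le> B * h2_norm f"
      using B[OF z] h2_norm_nonneg[OF f] by (intro mult_right_mono) auto
    finally show "cmod (f z) \<le> B * h2_norm f" .
  qed
qed

lemma H2_locally_uniform_limit:
  assumes f: "\<And>n::nat. f n \<in> H2" "\<And>n. h2_norm (f n) \<le> M" and g: "g holomorphic_on ball 0 1"
    and unif: "\<And>K. compact K \<Longrightarrow> K \<subseteq> ball 0 1 \<Longrightarrow> uniform_limit K f g sequentially"
  shows "g \<in> H2" "h2_norm g \<le> M"
proof -
  have "0 \<le> M" using order_trans[OF h2_norm_nonneg f(2)] f(1) by blast
  have mean: "h2_mean g s \<le> M\<^sup>2" if s: "0 \<le> s" "s < 1" for s
  proof (rule LIMSEQ_le_const2)
    show "(\<lambda>n. h2_mean (f n) s) \<longlonglongrightarrow> h2_mean g s"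
      using s
      by (intro h2_mean_tendsto unif holomorphic_on_subset_cball(2)[OF H2_holomorphic[OF f(1)] s(2)]) auto
    have "h2_mean (f n) s \<le> M\<^sup>2" for n
      using h2_mean_le_norm[OF f(1) s] power_mono[OF f(2) h2_norm_nonneg[OF f(1)], of _ 2]
      by (rule order_trans)
    then show "\<exists>N. \<forall>n\<ge>N. h2_mean (f n) s \<le> M\<^sup>2" by blast
  qed
  show "g \<in> H2" by (rule H2I[OF g mean])
  then have "(h2_norm g)\<^sup>2 \<le> M\<^sup>2" by (rule h2_norm_square_le) (rule mean)
  then show "h2_norm g \<le> M" using \<open>0 \<le> M\<close> by (rule power2_le_imp_le)
qed

lemma H2_Montel:
  fixes f :: "nat \<Rightarrow> complex \<Rightarrow> complex"
  assumes f: "\<And>n. f n \<in> H2" "\<And>n. h2_norm (f n) \<le> M"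
  obtains g r where "g \<in> H2" "h2_norm g \<le> M" "strict_mono (r :: nat \<Rightarrow> nat)"
    "\<And>K. compact K \<Longrightarrow> K \<subseteq> ball 0 1 \<Longrightarrow> uniform_limit K (\<lambda>n. f (r n)) g sequentially"
proof -
  obtain g r where g: "g holomorphic_on ball 0 1" and r: "strict_mono (r :: nat \<Rightarrow> nat)"
    and unif: "\<And>K. compact K \<Longrightarrow> K \<subseteq> ball 0 1 \<Longrightarrow> uniform_limit K (f \<circ> r) g sequentially"
  proof (rule Montel[of "ball 0 1" "range f" f])
    show "h holomorphic_on ball 0 1" if "h \<in> range f" for h using that H2_holomorphic f(1) by auto
    show "\<exists>B. \<forall>h\<in>range f. \<forall>z\<in>K. cmod (h z) \<le> B" if K: "compact K" "K \<subseteq> ball 0 1" for K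
    proof -
      obtain B where B: "\<And>f z. f \<in> H2 \<Longrightarrow> z \<in> K \<Longrightarrow> cmod (f z) \<le> B * h2_norm f"
        using H2_locally_bounded[OF K] by blast
      have "cmod (f n z) \<le> \<bar>B\<bar> * M" if "z \<in> K" for n z
        by (rule order_trans[OF B[OF f(1) that]]) (intro mult_mono h2_norm_nonneg f, auto)
      then show ?thesis by blast
    qed
  qed auto
  have limit: "uniform_limit K (\<lambda>n. f (r n)) g sequentially" if "compact K" "K \<subseteq> ball 0 1" for K
    using unif[OF that] by (simp add: o_def)
  from H2_locally_uniform_limit[of "\<lambda>n. f (r n)", OF f g limit]
  show thesis by (rule that[OF _ _ r limit])
qed

lemma h2_norm_wcomp_square_le:
  assumes \<phi>: "\<phi> holomorphic_on ball 0 1" "\<phi> ` ball 0 1 \<subseteq> ball 0 1"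
    and w: "w holomorphic_on ball 0 1" "w ` ball 0 1 \<subseteq> cball 0 1" and F: "F \<in> H2"
    and w_small: "\<And>z. z \<in> ball 0 1 \<Longrightarrow> \<rho> < cmod (\<phi> z) \<Longrightarrow> cmod (w z) \<le> \<eta>"
    and F_small: "\<And>z. z \<in> cball 0 \<rho> \<Longrightarrow> cmod (F z) \<le> \<eta>"
  shows "(h2_norm (wcomp w \<phi> F))\<^sup>2 \<le> \<eta>\<^sup>2 * (1 + harnack_const (\<phi> 0) * (h2_norm F)\<^sup>2)"
proof -
  have le: "(cmod (wcomp w \<phi> F z))\<^sup>2 \<le> \<eta>\<^sup>2 * (cmod 1)\<^sup>2 + \<eta>\<^sup>2 * (cmod (F (\<phi> z)))\<^sup>2" if "cmod z < 1" for z
  proof (cases "\<rho> < cmod (\<phi> z)")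
    case True
    then have "(cmod (w z))\<^sup>2 * (cmod (F (\<phi> z)))\<^sup>2 \<le> \<eta>\<^sup>2 * (cmod (F (\<phi> z)))\<^sup>2"
      using w_small[of z] that by (intro mult_right_mono power_mono) auto
    then show ?thesis
      by (simp add: wcomp_def norm_mult power_mult_distrib add_increasing)
  next
    case False
    then have "cmod (F (\<phi> z)) \<le> \<eta>" by (intro F_small) simp
    moreover have "cmod (w z) \<le> 1" using w(2) that by (auto simp: image_subset_iff)
    ultimately have "(cmod (w z) * cmod (F (\<phi> z)))\<^sup>2 \<le> (1 * \<eta>)\<^sup>2"
      by (intro power_mono mult_mono) auto
    then show ?thesis by (simp add: wcomp_def norm_mult add_increasing2)
  qed
  have "(h2_norm (wcomp w \<phi> F))\<^sup>2 \<le> \<eta>\<^sup>2 * (h2_norm (\<lambda>_. 1))\<^sup>2 + \<eta>\<^sup>2 * (h2_norm (\<lambda>z. F (\<phi> z)))\<^sup>2"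
    by (rule H2_dominated(2)[OF H2_holomorphic[OF wcomp_in_H2[OF \<phi> w F]] H2_const
          littlewood_subordination(1)[OF F \<phi>] le]) auto
  also have "\<dots> \<le> \<eta>\<^sup>2 * (1 + harnack_const (\<phi> 0) * (h2_norm F)\<^sup>2)"
    using mult_left_mono[OF littlewood_subordination(2)[OF F \<phi>] zero_le_power2[of \<eta>]]
    by (simp add: h2_norm_const distrib_left)
  finally show ?thesis .
qed

lemma wcomp_tendsto_0:
  assumes \<phi>: "\<phi> holomorphic_on ball 0 1" "\<phi> ` ball 0 1 \<subseteq> ball 0 1"
    and w: "w holomorphic_on ball 0 1" "w ` ball 0 1 \<subseteq> cball 0 1" and vanish: "vanishes_at_contact w \<phi>"
    and F: "\<And>n. F n \<in> H2" "\<And>n. (h2_norm (F n))\<^sup>2 \<le> M"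
    and unif: "\<And>\<rho>. \<rho> < 1 \<Longrightarrow> uniform_limit (cball 0 \<rho>) F (\<lambda>_. 0) sequentially"
  shows "(\<lambda>n::nat. h2_norm (wcomp w \<phi> (F n))) \<longlonglongrightarrow> 0"
proof -
  define C where "C = 1 + harnack_const (\<phi> 0) * M"
  have "cmod (\<phi> 0) < 1" using \<phi>(2) by (auto simp: image_subset_iff)
  then have harnack: "0 \<le> harnack_const (\<phi> 0)" by (intro less_imp_le harnack_const_pos)
  moreover have "0 \<le> M" using order_trans[OF zero_le_power2 F(2)] .
  ultimately have C: "0 < C" by (simp add: C_def add_pos_nonneg)
  have "(\<lambda>n. (h2_norm (wcomp w \<phi> (F n)))\<^sup>2) \<longlonglongrightarrow> 0"
  proof (rule order_tendstoI)
    fix a :: real assume "0 < a"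
    define \<eta> where "\<eta> = sqrt (a / 2 / C)"
    have \<eta>: "0 < \<eta>" "\<eta>\<^sup>2 * C = a / 2" using \<open>0 < a\<close> C by (simp_all add: \<eta>_def)
    obtain \<rho> where \<rho>: "\<rho> < 1" "\<And>z. z \<in> ball 0 1 \<Longrightarrow> \<rho> < cmod (\<phi> z) \<Longrightarrow> cmod (w z) \<le> \<eta>"
      using vanish \<eta>(1) unfolding vanishes_at_contact_def by blast
    from uniform_limitD[OF unif[OF \<rho>(1)] \<eta>(1)]
    show "\<forall>\<^sub>F n in sequentially. (h2_norm (wcomp w \<phi> (F n)))\<^sup>2 < a"
    proof eventually_elim
      case (elim n)
      have F_small: "cmod (F n z) \<le> \<eta>" if "z \<in> cball 0 \<rho>" for z using bspec[OF elim that] by simp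
      have "(h2_norm (wcomp w \<phi> (F n)))\<^sup>2 \<le> \<eta>\<^sup>2 * (1 + harnack_const (\<phi> 0) * (h2_norm (F n))\<^sup>2)"
        by (rule h2_norm_wcomp_square_le[OF \<phi> w F(1)]) (rule \<rho>(2) F_small, assumption+)+
      also have "\<dots> \<le> \<eta>\<^sup>2 * C"
        unfolding C_def by (intro mult_left_mono add_left_mono F(2) harnack) simp
      finally show ?case using \<eta>(2) \<open>0 < a\<close> by linarith
    qed
  qed (auto intro!: always_eventually order.strict_trans2[OF _ zero_le_power2])
  from tendsto_real_sqrt[OF this] show ?thesis
    by (simp add: h2_norm_nonneg wcomp_in_H2[OF \<phi> w F(1)])
qed

theorem compact_on_H2_wcomp:
  assumes \<phi>: "\<phi> holomorphic_on ball 0 1" "\<phi> ` ball 0 1 \<subseteq> ball 0 1"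
    and w: "w holomorphic_on ball 0 1" "w ` ball 0 1 \<subseteq> cball 0 1" and vanish: "vanishes_at_contact w \<phi>"
  shows "compact_on_H2 (wcomp w \<phi>)"
  unfolding compact_on_H2_def
proof (intro allI impI)
  fix f :: "nat \<Rightarrow> complex \<Rightarrow> complex"
  assume "\<forall>n. f n \<in> H2 \<and> h2_norm (f n) \<le> 1"
  then have f: "f n \<in> H2" "h2_norm (f n) \<le> 1" for n by auto
  obtain g r where g: "g \<in> H2" "h2_norm g \<le> 1" and r: "strict_mono (r :: nat \<Rightarrow> nat)"
    and unif: "\<And>K. compact K \<Longrightarrow> K \<subseteq> ball 0 1 \<Longrightarrow> uniform_limit K (\<lambda>n. f (r n)) g sequentially"
    by (rule H2_Montel[of f, OF f]) blast
  have "(\<lambda>n. h2_norm (wcomp w \<phi> (\<lambda>z. f (r n) z - g z))) \<longlonglongrightarrow> 0"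
  proof (rule wcomp_tendsto_0[OF \<phi> w vanish])
    show "(\<lambda>z. f (r n) z - g z) \<in> H2" for n by (intro H2_diff f g)
    have unit: "(h2_norm h)\<^sup>2 \<le> 1" if "h \<in> H2" "h2_norm h \<le> 1" for h
      using power_le_one[OF h2_norm_nonneg[OF that(1)] that(2)] .
    show "(h2_norm (\<lambda>z. f (r n) z - g z))\<^sup>2 \<le> 4" for n
      using H2_diff(2)[OF f(1) g(1), of "r n"] unit[OF f, of "r n"] unit[OF g] by linarith
    show "uniform_limit (cball 0 \<rho>) (\<lambda>n z. f (r n) z - g z) (\<lambda>_. 0) sequentially" if "\<rho> < 1" for \<rho>
    proof -
      have "uniform_limit (cball 0 \<rho>) (\<lambda>n. f (r n)) g sequentially" using that by (intro unif) auto
      from uniform_limit_minus[OF this uniform_limit_const[where c = g]] show ?thesis by simp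
    qed
  qed
  then have "(\<lambda>n. h2_norm (\<lambda>z. wcomp w \<phi> (f (r n)) z - wcomp w \<phi> g z)) \<longlonglongrightarrow> 0"
    by (simp add: wcomp_def right_diff_distrib)
  then show "\<exists>\<sigma> h. strict_mono \<sigma> \<and> h \<in> H2 \<and> (\<lambda>n. h2_norm (\<lambda>z. wcomp w \<phi> (f (\<sigma> n)) z - h z)) \<longlonglongrightarrow> 0"
    using r wcomp_in_H2[OF \<phi> w g(1)] by blast
qed

theorem theorem3p1:
  fixes \<phi> :: "complex \<Rightarrow> complex"
  assumes "\<phi> holomorphic_on ball 0 1"
      and "\<phi> ` ball 0 1 \<subseteq> ball 0 1"
  shows "(\<exists>w\<in>H2. (\<exists>z\<in>ball 0 1. w z \<noteq> 0) \<and>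
            bounded_on_H2 (wcomp w \<phi>) \<and> compact_on_H2 (wcomp w \<phi>))
         \<longleftrightarrow> (AE t in lborel. t \<in> {0..2*pi} \<longrightarrow> \<not> radial_unimodular \<phi> t)"
    (is "?compact_weight \<longleftrightarrow> _")
proof -
  have closed: "\<phi> ` ball 0 1 \<subseteq> cball 0 1" using assms(2) ball_subset_cball by blast
  have "?compact_weight \<longleftrightarrow> (\<lambda>k. (h2_norm (\<lambda>z. \<phi> z ^ k))\<^sup>2) \<longlonglongrightarrow> 0"
  proof
    show "(\<lambda>k. (h2_norm (\<lambda>z. \<phi> z ^ k))\<^sup>2) \<longlonglongrightarrow> 0" if ?compact_weight
      using that compact_wcomp_imp_power_norms_tendsto_0[OF assms] by blast
    assume "(\<lambda>k. (h2_norm (\<lambda>z. \<phi> z ^ k))\<^sup>2) \<longlonglongrightarrow> 0"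
    then obtain w where w: "w holomorphic_on ball 0 1" "w ` ball 0 1 \<subseteq> cball 0 1" "w 0 \<noteq> 0"
      and vanish: "vanishes_at_contact w \<phi>"
      by (rule ex_weight_vanishing[OF assms])
    show ?compact_weight
    proof (intro bexI conjI)
      show "w \<in> H2" by (rule H2_bounded(1)[OF w(1,2)])
      show "w 0 \<noteq> 0" "(0 :: complex) \<in> ball 0 1" using w(3) by simp_all
      show "bounded_on_H2 (wcomp w \<phi>)" by (rule bounded_on_H2_wcomp[OF assms w(1,2)])
      show "compact_on_H2 (wcomp w \<phi>)" by (rule compact_on_H2_wcomp[OF assms w(1,2) vanish])
    qed
  qed
  also note h2_norm_power_tendsto_0_iff[OF assms(1) closed]
  finally show ?thesis .
qed

end
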